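(* Let $n\ge 1$, $\delta\in(0,n]$, $\alpha\in(0,\delta)$ and $p\in(\delta/n,\delta/\alpha)$. Then there exists a constant $c$, depending only on $n$, $\delta$, $\alpha$ and $p$, such that for all functions $f:\mathbb{R}^n\to[-\infty,\infty]$ (not assumed to be Lebesgue measurable) $$\bigg(\int_{\mathbb{R}^n}\big(\mathcal{R}^n_\alpha f(x)\big)^{\frac{\delta p}{\delta-p\alpha}}\,d\mathcal{H}^\delta_\infty\bigg)^{\frac{\delta-p\alpha}{\delta p}}\le c\,\bigg(\int_{\mathbb{R}^n}|f(x)|^p\,d\mathcal{H}^\delta_\infty\bigg)^{\frac1p}.$$
   Context: For $\delta\in(0,n]$ and any set $E\subset\mathbb{R}^n$, the $\delta$-dimensional Hausdorff content is $\mathcal{H}^\delta_\infty(E):=\inf\{\sum_{i} r_i^\delta : E\subset\bigcup_{i} B(x_i,r_i)\}$, the infimum being over all countable (or finite) collections of open balls covering $E$. For an arbitrary set $\Omega\subset\mathbb{R}^n$ and an arbitrary function $g:\Omega\to[0,\infty]$ (no measurability required), the integral with respect to $\mathcal{H}^\delta_\infty$ is the Choquet integral $\int_\Omega g\,d\mathcal{H}^\delta_\infty:=\int_0^\infty \mathcal{H}^\delta_\infty(\{x\in\Omega: g(x)>t\})\,dt$. The Hausdorff content Riesz potential of $f:\mathbb{R}^n\to[-\infty,\infty]$ is, for $\delta\in(0,n]$ and $\alpha\in(0,\delta)$, $$\mathcal{R}^\delta_\alpha f(x):=\int_{\mathbb{R}^n}\frac{|f(y)|}{|x-y|^{\delta-\alpha}}\,d\mathcal{H}^\delta_\infty(y),\qquad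 x\in\mathbb{R}^n.$$ In particular $\mathcal{R}^n_\alpha f(x)=\int_{\mathbb{R}^n}|f(y)|\,|x-y|^{\alpha-n}\,d\mathcal{H}^n_\infty(y)$. *)

theory Defs
  imports "HOL-Analysis.Analysis"
begin

text \<open>
  Radii in a cover may be 0. Since \<open>ball c 0 = {}\<close> and \<open>0 powr \<delta> = 0\<close>, such entries
  contribute nothing, so sequences indexed by \<^typ>\<open>nat\<close> describe both the finite and the
  countably infinite covers by open balls.
\<close>

definition hausdorff_content :: "real \<Rightarrow> 'a::metric_space set \<Rightarrow> ennreal" where
  "hausdorff_content \<delta> E =
     Inf {(\<Sum>i. ennreal (r i powr \<delta>)) | (c :: nat \<Rightarrow> 'a) (r :: nat \<Rightarrow> real).
            (\<forall>i. 0 \<le> r i) \<and> E \<subseteq> (\<Union>i. ball (c i) (r i))}"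

text \<open>
  The level-set function below is decreasing in \<open>t\<close>, hence Borel, whatever \<open>g\<close> and
  \<open>\<Omega>\<close> are; so the Lebesgue integral has its usual meaning and no measurability is needed.
\<close>

definition choquet_integral ::
    "real \<Rightarrow> 'a::metric_space set \<Rightarrow> ('a \<Rightarrow> ennreal) \<Rightarrow> ennreal" where
  "choquet_integral \<delta> \<Omega> g =
     (\<integral>\<^sup>+ t \<in> {0<..}. hausdorff_content \<delta> {x \<in> \<Omega>. g x > ennreal t} \<partial>lborel)"

text \<open>Real powers on \<open>[0, \<infinity>]\<close>, intended for positive exponents: \<open>0\<close> and \<open>\<infinity>\<close> are fixed.\<close>

definition ennreal_powr :: "ennreal \<Rightarrow> real \<Rightarrow> ennreal" where
  "ennreal_powr x a = (if x = top then top else ennreal (enn2real x powr a))"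

text \<open>
  At \<open>y = x\<close> the division in \<^typ>\<open>ennreal\<close> gives \<open>\<infinity>\<close> if \<open>f x \<noteq> 0\<close> and \<open>0\<close> otherwise. A single
  point has content 0, so the value there does not affect the integral.
\<close>

definition content_riesz_potential ::
    "real \<Rightarrow> real \<Rightarrow> (real ^ 'n \<Rightarrow> ereal) \<Rightarrow> real ^ 'n \<Rightarrow> ennreal" where
  "content_riesz_potential \<delta> \<alpha> f x =
     choquet_integral \<delta> UNIV (\<lambda>y. e2ennreal \<bar>f y\<bar> / ennreal (norm (x - y) powr (\<delta> - \<alpha>)))"

end

theory Submission
  imports Defs
begin

text \<open>
  Write \<open>D\<close> for the dimension, \<open>h\<close> for the \<open>\<delta>\<close>-dimensional content, \<open>H\<close> for the \<open>D\<close>-dimensional one,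
  \<open>\<phi> = \<bar>f\<bar>\<close>, \<open>F j = {\<phi> > 2 powr j}\<close> for integers \<open>j\<close>, and \<open>N\<close> for the Choquet integral of
  \<open>\<phi> powr p\<close> with respect to \<open>h\<close>. The proof follows Hedberg: the potential is bounded pointwise by
  a maximal function, and the maximal function is bounded on the Choquet space of exponent \<open>p\<close>.

  All functions are replaced by their dyadic layers. This turns Choquet integrals into sums over
  the integers of contents of level sets (\<open>choquet_le_dyadic_sum\<close>, \<open>dyadic_sum_le_choquet\<close>), and
  thereby avoids the question whether the Choquet integral is sublinear: countable subadditivity
  of the content suffices. The number
  \<open>S k x = (\<Sum>j. 2 powr j * H (F j \<inter> ball x (2 powr k)))\<close> plays the role of the integral of
  \<open>\<phi>\<close> over \<open>ball x (2 powr k)\<close>, and the potential at \<open>x\<close> is at most a constant times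
  \<open>\<Sum>k. 2 powr ((\<alpha> - D) * k) * S k x\<close> (\<open>riesz_potential_le_dyadic_sum\<close>).

  For large \<open>k\<close>, Chebyshev's inequality \<open>h (F j) \<le> C * N * 2 powr (- p * j)\<close> and the comparison
  \<open>H E \<le> h E powr (D / \<delta>)\<close> bound \<open>S k x\<close> by a multiple of
  \<open>N powr (1 / p) * 2 powr ((D - \<delta> / p) * k)\<close>; this needs \<open>p > \<delta> / D\<close>. For small \<open>k\<close>, \<open>S k x\<close> is at most
  \<open>2 powr (D * k)\<close> times the maximal function \<open>m x\<close>, the supremum over \<open>r > 0\<close> of
  \<open>r powr (- D) * (\<Sum>j. 2 powr j * H (F j \<inter> ball x r))\<close>. As \<open>0 < \<alpha> < \<delta> / p\<close>, both resulting series are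
  geometric, and the potential is at most
  \<open>C * N powr (\<alpha> / \<delta>) * m x powr (1 - \<alpha> * p / \<delta>)\<close> (\<open>hedberg_dyadic\<close>). The exponent
  \<open>\<delta> * p / (\<delta> - p * \<alpha>)\<close> turns the last factor into \<open>m x powr p\<close>.

  The maximal theorem (\<open>layered_maximal_strong\<close>) says that the integral of \<open>m powr p\<close> is at most
  \<open>C * N\<close>. It is derived from a weak-type bound for single sets (\<open>content_maximal_weak\<close>), which a
  Vitali covering argument gives directly from any cover of the set. The lemmas allow any real
  exponent \<open>D\<close> in place of the dimension, as only \<open>\<delta> \<le> D\<close> and \<open>\<alpha> < D\<close> matter.
\<close>

section \<open>Dyadic sums over the integers\<close>

text \<open>
  The value of the two-sided geometric series \<open>\<Sum>i\<in>\<int>. 2 powr (- c * \<bar>i\<bar>)\<close>, finite for \<open>c > 0\<close>.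
  Sums over the integers are written as integrals against the counting measure, so that they
  live in \<^typ>\<open>ennreal\<close> and may be interchanged freely.
\<close>

definition geom_const :: "real \<Rightarrow> real" where
  "geom_const c = enn2real (\<integral>\<^sup>+ i. ennreal (2 powr (- c * \<bar>real_of_int i\<bar>)) \<partial>count_space (UNIV :: int set))"

lemma int_decode_abs_ge: "real n / 2 \<le> \<bar>real_of_int (int_decode n)\<bar>"
proof (cases "even n")
  case True
  then show ?thesis by (auto simp: int_decode_def sum_decode_def elim!: evenE)
next
  case False
  then show ?thesis by (auto simp: int_decode_def sum_decode_def elim!: oddE)
qed

lemma geom_sum_int:
  assumes "c > 0"
  shows "(\<integral>\<^sup>+ i. ennreal (2 powr (- c * \<bar>real_of_int i\<bar>)) \<partial>count_space (UNIV :: int set)) = ennreal (geom_const c)"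
proof -
  define \<theta> where "\<theta> = 2 powr (- c / 2)"
  have \<theta>: "0 < \<theta>" "\<theta> < 1"
    using assms by (auto simp: \<theta>_def powr_less_one)
  have "(\<integral>\<^sup>+ i. ennreal (2 powr (- c * \<bar>real_of_int i\<bar>)) \<partial>count_space (UNIV :: int set))
      = (\<integral>\<^sup>+ n. ennreal (2 powr (- c * \<bar>real_of_int (int_decode n)\<bar>)) \<partial>count_space UNIV)"
    by (rule nn_integral_bij_count_space[OF bij_int_decode, symmetric])
  also have "\<dots> \<le> (\<integral>\<^sup>+ n. ennreal (\<theta> ^ n) \<partial>count_space UNIV)"
  proof (intro nn_integral_mono ennreal_leI)
    fix n :: nat
    have "2 powr (- c * \<bar>real_of_int (int_decode n)\<bar>) \<le> 2 powr (- c * (real n / 2))"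
      using int_decode_abs_ge[of n] assms by (intro powr_mono) auto
    also have "\<dots> = \<theta> ^ n"
      by (simp add: \<theta>_def powr_powr flip: powr_realpow)
    finally show "2 powr (- c * \<bar>real_of_int (int_decode n)\<bar>) \<le> \<theta> ^ n" .
  qed
  also have "\<dots> = (\<Sum>n. ennreal (\<theta> ^ n))"
    by (rule nn_integral_count_space_nat)
  also have "\<dots> = ennreal (\<Sum>n. \<theta> ^ n)"
    using \<theta> by (intro suminf_ennreal2) (auto intro!: summable_geometric)
  also have "\<dots> < top" by simp
  finally show ?thesis by (simp add: geom_const_def)
qed

lemma geom_const_ge_1:
  assumes "c > 0"
  shows "1 \<le> geom_const c"
proof -
  have "ennreal 1 \<le> ennreal (geom_const c)"
    unfolding geom_sum_int[OF assms, symmetric]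
    using nn_integral_ge_point[of "0::int" UNIV "\<lambda>i. ennreal (2 powr (- c * \<bar>real_of_int i\<bar>))"] by simp
  moreover have "0 \<le> geom_const c" by (simp add: geom_const_def)
  ultimately show ?thesis by (simp only: ennreal_le_iff)
qed

lemma geom_sum_int_shift:
  assumes "c > 0"
  shows "(\<integral>\<^sup>+ i. ennreal (2 powr (- c * \<bar>real_of_int i - real_of_int j\<bar>)) \<partial>count_space (UNIV :: int set)) = ennreal (geom_const c)"
proof -
  have "bij (\<lambda>i::int. i - j)"
    by (rule bij_betw_byWitness[where f' = "\<lambda>i. i + j"]) auto
  from nn_integral_bij_count_space[OF this, of "\<lambda>i. ennreal (2 powr (- c * \<bar>real_of_int i\<bar>))"]
  show ?thesis using geom_sum_int[OF assms] by simp
qed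

text \<open>
  The minimum of an increasing and a decreasing geometric progression sums to a multiple of the
  common value at the real point where the two progressions cross.
\<close>

lemma two_sided_geom_sum:
  fixes a b A B :: real
  assumes "a > 0" "b > 0" "A > 0" "B > 0"
  shows "(\<integral>\<^sup>+ j. ennreal (min (A * 2 powr (a * real_of_int j)) (B * 2 powr (- b * real_of_int j))) \<partial>count_space (UNIV :: int set))
    \<le> ennreal (2 powr min a b * geom_const (min a b) * (A powr (b / (a + b)) * B powr (a / (a + b))))"
proof -
  define c where "c = min a b"
  have c: "c > 0" "c \<le> a" "c \<le> b" using assms by (auto simp: c_def)
  define s where "s = (log 2 B - log 2 A) / (a + b)"
  define V where "V = A powr (b / (a + b)) * B powr (a / (a + b))"
  have V: "V > 0" using assms by (simp add: V_def)
  have lV: "log 2 V * (a + b) = b * log 2 A + a * log 2 B"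
  proof -
    have "log 2 V = b / (a + b) * log 2 A + a / (a + b) * log 2 B"
      using assms by (simp add: V_def log_mult log_powr)
    then show ?thesis using assms by (simp add: distrib_right)
  qed
  have ls: "s * (a + b) = log 2 B - log 2 A"
    using assms by (simp add: s_def)
  \<comment> \<open>\<open>s\<close> is the real position at which the two geometric progressions agree, with value \<open>V\<close>\<close>
  have A: "A = V * 2 powr (- a * s)"
  proof -
    have "(log 2 V + (- a * s)) * (a + b) = log 2 A * (a + b)"
      using lV ls by algebra
    then have "log 2 V + (- a * s) = log 2 A"
      using assms by simp
    then have "log 2 A = log 2 (V * 2 powr (- a * s))"
      using V by (simp add: log_mult)
    then show ?thesis using V assms by (subst (asm) log_inj[THEN inj_on_eq_iff]) auto
  qed
  have B: "B = V * 2 powr (b * s)"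
  proof -
    have "(log 2 V + (b * s)) * (a + b) = log 2 B * (a + b)"
      using lV ls by algebra
    then have "log 2 V + (b * s) = log 2 B"
      using assms by simp
    then have "log 2 B = log 2 (V * 2 powr (b * s))"
      using V by (simp add: log_mult)
    then show ?thesis using V assms by (subst (asm) log_inj[THEN inj_on_eq_iff]) auto
  qed
  have le: "min (A * 2 powr (a * real_of_int j)) (B * 2 powr (- b * real_of_int j))
      \<le> V * 2 powr c * 2 powr (- c * \<bar>real_of_int j - real_of_int \<lfloor>s\<rfloor>\<bar>)" for j :: int
  proof -
    have fl: "real_of_int \<lfloor>s\<rfloor> \<le> s" "s < real_of_int \<lfloor>s\<rfloor> + 1" by linarith+
    have "min (A * 2 powr (a * real_of_int j)) (B * 2 powr (- b * real_of_int j))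
        = min (V * 2 powr (a * (real_of_int j - s))) (V * 2 powr (- b * (real_of_int j - s)))"
      by (subst A, subst B) (simp add: algebra_simps powr_add[symmetric])
    also have "\<dots> \<le> V * 2 powr (- c * \<bar>real_of_int j - s\<bar>)"
    proof (cases "real_of_int j \<le> s")
      case True
      then have "a * (real_of_int j - s) \<le> - c * \<bar>real_of_int j - s\<bar>"
        using c mult_right_mono[of c a "s - real_of_int j"] by (simp add: algebra_simps)
      then show ?thesis using V by (intro min.coboundedI1 mult_left_mono powr_mono) auto
    next
      case False
      then have "- b * (real_of_int j - s) \<le> - c * \<bar>real_of_int j - s\<bar>"
        using c mult_right_mono[of c b "real_of_int j - s"] by (simp add: algebra_simps)
      then show ?thesis using V by (intro min.coboundedI2 mult_left_mono powr_mono) auto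
    qed
    also have "\<dots> \<le> V * 2 powr (c + - c * \<bar>real_of_int j - real_of_int \<lfloor>s\<rfloor>\<bar>)"
    proof -
      have "\<bar>real_of_int j - real_of_int \<lfloor>s\<rfloor>\<bar> \<le> \<bar>real_of_int j - s\<bar> + 1" using fl by linarith
      from mult_left_mono[OF this, of c] have "- c * \<bar>real_of_int j - s\<bar> \<le> c + - c * \<bar>real_of_int j - real_of_int \<lfloor>s\<rfloor>\<bar>"
        using c by (simp add: algebra_simps)
      then show ?thesis using V by (intro mult_left_mono powr_mono) auto
    qed
    finally show ?thesis by (simp only: powr_add mult.assoc)
  qed
  have "(\<integral>\<^sup>+ j. ennreal (min (A * 2 powr (a * real_of_int j)) (B * 2 powr (- b * real_of_int j))) \<partial>count_space (UNIV :: int set))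
    \<le> (\<integral>\<^sup>+ j. ennreal (V * 2 powr c) * ennreal (2 powr (- c * \<bar>real_of_int j - real_of_int \<lfloor>s\<rfloor>\<bar>)) \<partial>count_space (UNIV :: int set))"
    using le V by (intro nn_integral_mono) (simp add: ennreal_mult[symmetric] del: min_le_iff_disj)
  also have "\<dots> = ennreal (V * 2 powr c) * ennreal (geom_const c)"
    using geom_sum_int_shift[OF c(1)] by (simp add: nn_integral_cmult)
  also have "\<dots> = ennreal (2 powr c * geom_const c * V)"
    using V geom_const_ge_1[OF c(1)] by (simp add: ennreal_mult[symmetric] mult_ac)
  finally show ?thesis by (simp add: c_def V_def)
qed

section \<open>Hausdorff content\<close>

lemma content_mono: "E \<subseteq> F \<Longrightarrow> hausdorff_content d E \<le> hausdorff_content d F"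
  unfolding hausdorff_content_def by (rule Inf_superset_mono) blast


text \<open>
  Covers may be indexed by any countable set, not only by the natural numbers.
\<close>

lemma content_le_cover:
  fixes c :: "'i \<Rightarrow> 'a::metric_space"
  assumes I: "countable I" and r: "\<And>i. i \<in> I \<Longrightarrow> 0 \<le> r i"
    and E: "E \<subseteq> (\<Union>i\<in>I. ball (c i) (r i))"
  shows "hausdorff_content d E \<le> (\<integral>\<^sup>+ i. ennreal (r i powr d) \<partial>count_space I)"
proof -
  define J where "J = to_nat_on I ` I"
  define g where "g = from_nat_into I"
  have g: "bij_betw g J I"
    unfolding g_def J_def by (rule bij_betw_byWitness[where f' = "to_nat_on I"]) (use I in auto)
  define r' where "r' n = (if n \<in> J then r (g n) else 0)" for n
  have r'_nonneg: "\<forall>n. 0 \<le> r' n" using r g by (auto simp: r'_def bij_betw_def)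
  have "E \<subseteq> (\<Union>n. ball (c (g n)) (r' n))"
  proof
    fix x assume "x \<in> E"
    then obtain i where "i \<in> I" "x \<in> ball (c i) (r i)" using E by auto
    moreover obtain n where "n \<in> J" "i = g n" using g \<open>i \<in> I\<close> by (auto simp: bij_betw_def)
    ultimately show "x \<in> (\<Union>n. ball (c (g n)) (r' n))" by (auto simp: r'_def intro!: exI[of _ n])
  qed
  then have "hausdorff_content d E \<le> (\<Sum>n. ennreal (r' n powr d))"
    unfolding hausdorff_content_def using r'_nonneg
    by (intro Inf_lower CollectI exI[of _ "\<lambda>n. c (g n)"] exI[of _ r']) auto
  also have "\<dots> = (\<integral>\<^sup>+ n. ennreal (r' n powr d) \<partial>count_space UNIV)"
    by (rule nn_integral_count_space_nat[symmetric])
  also have "\<dots> = (\<integral>\<^sup>+ n. ennreal (r (g n) powr d) \<partial>count_space J)"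
    by (subst nn_integral_count_space_indicator)
      (auto intro!: nn_integral_cong simp: r'_def split: split_indicator)
  also have "\<dots> = (\<integral>\<^sup>+ i. ennreal (r i powr d) \<partial>count_space I)"
    by (rule nn_integral_bij_count_space[OF g])
  finally show ?thesis .
qed

lemma content_empty [simp]: "hausdorff_content d {} = 0"
  using content_le_cover[of "{}" "\<lambda>_. 0" "{}" "\<lambda>_. undefined" d] by (simp add: nn_integral_empty)

lemma content_ball_le:
  fixes x :: "'a::metric_space"
  assumes "0 \<le> r"
  shows "hausdorff_content d (ball x r) \<le> ennreal (r powr d)"
  using content_le_cover[of "{()}" "\<lambda>_. r" "ball x r" "\<lambda>_. x" d] assms
  by (simp add: nn_integral_count_space_finite)

lemma content_singleton:
  fixes x :: "'a::metric_space"
  assumes "0 < d"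
  shows "hausdorff_content d {x} = 0"
proof (rule antisym)
  show "hausdorff_content d {x} \<le> 0"
  proof (rule ennreal_le_epsilon)
    fix e :: real assume "0 < e"
    have "hausdorff_content d {x} \<le> hausdorff_content d (ball x (e powr (1 / d)))"
      using \<open>0 < e\<close> by (intro content_mono) auto
    also have "\<dots> \<le> ennreal ((e powr (1 / d)) powr d)" by (rule content_ball_le) simp
    also have "(e powr (1 / d)) powr d = e" using assms \<open>0 < e\<close> by (simp add: powr_powr)
    finally show "hausdorff_content d {x} \<le> 0 + ennreal e" by simp
  qed
qed simp

lemma content_lessE:
  fixes E :: "'a::metric_space set"
  assumes "hausdorff_content d E < b"
  obtains c :: "nat \<Rightarrow> 'a" and r :: "nat \<Rightarrow> real" where "\<And>i. 0 \<le> r i" "E \<subseteq> (\<Union>i. ball (c i) (r i))"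
    "(\<integral>\<^sup>+ i. ennreal (r i powr d) \<partial>count_space UNIV) < b"
proof -
  from assms show ?thesis
    unfolding hausdorff_content_def Inf_less_iff nn_integral_count_space_nat[symmetric]
    using that by blast
qed

lemma content_geI:
  fixes E :: "'a::metric_space set"
  assumes K: "K > 0"
    and *: "\<And>(c :: nat \<Rightarrow> 'a) r. (\<And>i. 0 \<le> r i) \<Longrightarrow> E \<subseteq> (\<Union>i. ball (c i) (r i)) \<Longrightarrow>
        X \<le> ennreal K * (\<integral>\<^sup>+ i. ennreal (r i powr d) \<partial>count_space UNIV)"
  shows "X \<le> ennreal K * hausdorff_content d E"
proof -
  have inv: "ennreal (1 / K) * ennreal K = 1"
    using K by (simp flip: ennreal_mult)
  have "ennreal (1 / K) * X \<le> hausdorff_content d E"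
    unfolding hausdorff_content_def
  proof (rule Inf_greatest, clarify)
    fix c :: "nat \<Rightarrow> 'a" and r :: "nat \<Rightarrow> real"
    assume "\<forall>i. 0 \<le> r i" "E \<subseteq> (\<Union>i. ball (c i) (r i))"
    then have "X \<le> ennreal K * (\<Sum>i. ennreal (r i powr d))"
      using * by (simp add: nn_integral_count_space_nat)
    then have "ennreal (1 / K) * X \<le> ennreal (1 / K) * (ennreal K * (\<Sum>i. ennreal (r i powr d)))"
      by (rule mult_left_mono) simp
    then show "ennreal (1 / K) * X \<le> (\<Sum>i. ennreal (r i powr d))"
      by (simp only: mult.assoc[symmetric] inv mult_1_left)
  qed
  then have "ennreal K * (ennreal (1 / K) * X) \<le> ennreal K * hausdorff_content d E"
    by (rule mult_left_mono) simp
  moreover have "ennreal K * (ennreal (1 / K) * X) = X"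
    using inv by (simp only: mult.assoc[symmetric] mult.commute[of "ennreal K"] mult_1_left)
  ultimately show ?thesis by simp
qed

lemma content_countable_subadd:
  fixes E :: "'i::countable \<Rightarrow> 'a::metric_space set"
  shows "hausdorff_content d (\<Union>i. E i) \<le> (\<integral>\<^sup>+ i. hausdorff_content d (E i) \<partial>count_space UNIV)"
proof (rule ennreal_le_epsilon)
  fix e :: real
  assume fin: "(\<integral>\<^sup>+ i. hausdorff_content d (E i) \<partial>count_space UNIV) < top" and e: "0 < e"
  define w where "w i = e * (1 / 2) ^ Suc (to_nat i)" for i :: 'i
  have w: "w i > 0" for i using e by (simp add: w_def)
  have "\<exists>c r. (\<forall>n. 0 \<le> r n) \<and> E i \<subseteq> (\<Union>n. ball (c n) (r n)) \<and>
      (\<integral>\<^sup>+ n. ennreal (r n powr d) \<partial>count_space (UNIV :: nat set)) \<le> hausdorff_content d (E i) + ennreal (w i)" for i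
  proof -
    have "hausdorff_content d (E i) < top"
      using nn_integral_ge_point[of i UNIV "\<lambda>i. hausdorff_content d (E i)"] fin by simp
    then have "hausdorff_content d (E i) < hausdorff_content d (E i) + ennreal (w i)"
      using w[of i] by (simp add: ennreal_add_left_cancel_less ennreal_less_zero_iff)
    then show ?thesis by (elim content_lessE) (blast intro: less_imp_le)
  qed
  then obtain c r where r: "\<And>i n. 0 \<le> r i n" and cov: "\<And>i. E i \<subseteq> (\<Union>n. ball (c i n) (r i n))"
    and le: "\<And>i. (\<integral>\<^sup>+ n. ennreal (r i n powr d) \<partial>count_space (UNIV :: nat set)) \<le> hausdorff_content d (E i) + ennreal (w i)"
    by metis
  have "hausdorff_content d (\<Union>i. E i) \<le> (\<integral>\<^sup>+ z. ennreal (case_prod r z powr d) \<partial>count_space UNIV)"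
  proof (rule content_le_cover[where c = "case_prod c"])
    show "(\<Union>i. E i) \<subseteq> (\<Union>z\<in>UNIV. ball (case_prod c z) (case_prod r z))"
      using cov by fastforce
  qed (auto simp: r)
  also have "\<dots> = (\<integral>\<^sup>+ i. \<integral>\<^sup>+ n. ennreal (r i n powr d) \<partial>count_space UNIV \<partial>count_space UNIV)"
    by (subst nn_integral_fst_count_space[symmetric]) simp
  also have "\<dots> \<le> (\<integral>\<^sup>+ i. hausdorff_content d (E i) + ennreal (w i) \<partial>count_space UNIV)"
    by (intro nn_integral_mono le)
  also have "\<dots> = (\<integral>\<^sup>+ i. hausdorff_content d (E i) \<partial>count_space UNIV) + (\<integral>\<^sup>+ i. ennreal (w i) \<partial>count_space UNIV)"
    by (rule nn_integral_add) auto
  also have "(\<integral>\<^sup>+ i. ennreal (w i) \<partial>count_space UNIV) \<le> ennreal e"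
  proof -
    have "(\<integral>\<^sup>+ i. ennreal (w i) \<partial>count_space UNIV)
        = (\<integral>\<^sup>+ n. ennreal (e * (1 / 2) ^ Suc n) \<partial>count_space (range (to_nat :: 'i \<Rightarrow> nat)))"
      unfolding w_def
      by (rule nn_integral_bij_count_space) (simp add: bij_betw_def)
    also have "\<dots> \<le> (\<integral>\<^sup>+ n. ennreal (e * (1 / 2) ^ Suc n) \<partial>count_space UNIV)"
      by (subst nn_integral_count_space_indicator)
        (auto intro!: nn_integral_mono split: split_indicator)
    also have "\<dots> = (\<Sum>n. ennreal (e * (1 / 2) ^ Suc n))"
      by (rule nn_integral_count_space_nat)
    also have "\<dots> = ennreal e"
      using sums_mult[OF power_half_series, of e] e by (intro suminf_ennreal_eq) (auto simp: algebra_simps)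
    finally show ?thesis by simp
  qed
  finally show "hausdorff_content d (\<Union>i. E i) \<le> (\<integral>\<^sup>+ i. hausdorff_content d (E i) \<partial>count_space UNIV) + ennreal e"
    by (simp add: add_left_mono)
qed

lemma content_Un_le:
  fixes A B :: "'a::metric_space set"
  shows "hausdorff_content d (A \<union> B) \<le> hausdorff_content d A + hausdorff_content d B"
proof -
  have "A \<union> B = (\<Union>b. if b then A else B)" by (auto split: if_splits)
  then have "hausdorff_content d (A \<union> B) \<le> (\<integral>\<^sup>+ b. hausdorff_content d (if b then A else B) \<partial>count_space UNIV)"
    using content_countable_subadd[of d "\<lambda>b. if b then A else B"] by simp
  then show ?thesis by (simp add: nn_integral_count_space_finite UNIV_bool add.commute)
qed

text \<open>
  The embedding of \<open>\<ell>\<close>-spaces, \<open>\<Sum>\<rho> powr D \<le> (\<Sum>\<rho> powr \<delta>) powr (D / \<delta>)\<close> for \<open>\<delta> \<le> D\<close>.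
  It is the only link between the contents of different exponents.
\<close>

lemma sum_powr_le:
  fixes \<rho> :: "'i \<Rightarrow> real"
  assumes "0 < \<delta>" "\<delta> \<le> D" "0 \<le> b" and \<rho>: "\<And>i. 0 \<le> \<rho> i"
    and le: "(\<integral>\<^sup>+ i. ennreal (\<rho> i powr \<delta>) \<partial>count_space I) \<le> ennreal b"
  shows "(\<integral>\<^sup>+ i. ennreal (\<rho> i powr D) \<partial>count_space I) \<le> ennreal (b powr (D / \<delta>))"
proof -
  have "ennreal (\<rho> i powr D) \<le> ennreal (b powr ((D - \<delta>) / \<delta>)) * ennreal (\<rho> i powr \<delta>)" if "i \<in> I" for i
  proof (cases "\<rho> i = 0")
    case False
    then have pos: "\<rho> i > 0" using \<rho>[of i] by simp
    have "ennreal (\<rho> i powr \<delta>) \<le> ennreal b"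
      by (rule order_trans[OF nn_integral_ge_point[OF that] le])
    then have b: "\<rho> i powr \<delta> \<le> b" using assms by simp
    have "\<rho> i powr D = (\<rho> i powr \<delta>) powr ((D - \<delta>) / \<delta>) * \<rho> i powr \<delta>"
      using assms by (simp add: powr_powr powr_add[symmetric])
    also have "\<dots> \<le> b powr ((D - \<delta>) / \<delta>) * \<rho> i powr \<delta>"
      using b assms by (intro mult_right_mono powr_mono2) auto
    finally show ?thesis by (simp flip: ennreal_mult)
  qed simp
  then have "(\<integral>\<^sup>+ i. ennreal (\<rho> i powr D) \<partial>count_space I)
      \<le> (\<integral>\<^sup>+ i. ennreal (b powr ((D - \<delta>) / \<delta>)) * ennreal (\<rho> i powr \<delta>) \<partial>count_space I)"
    by (intro nn_integral_mono) auto
  also have "\<dots> \<le> ennreal (b powr ((D - \<delta>) / \<delta>)) * ennreal b"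
    using le by (simp add: nn_integral_cmult mult_left_mono)
  also have "\<dots> = ennreal (b powr (D / \<delta>))"
  proof (cases "b = 0")
    case False
    then have "b powr ((D - \<delta>) / \<delta>) * b = b powr ((D - \<delta>) / \<delta> + 1)" using assms by (simp add: powr_add)
    also have "(D - \<delta>) / \<delta> + 1 = D / \<delta>" using assms by (simp add: field_simps)
    finally show ?thesis using assms by (simp flip: ennreal_mult)
  qed simp
  finally show ?thesis .
qed

lemma content_higher_exponent_le:
  fixes E :: "'a::metric_space set"
  assumes "0 < \<delta>" "\<delta> \<le> D" "0 \<le> b" "hausdorff_content \<delta> E < ennreal b"
  shows "hausdorff_content D E \<le> ennreal (b powr (D / \<delta>))"
proof -
  obtain c :: "nat \<Rightarrow> 'a" and r :: "nat \<Rightarrow> real" where *: "\<And>i. 0 \<le> r i" "E \<subseteq> (\<Union>i. ball (c i) (r i))"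
    "(\<integral>\<^sup>+ i. ennreal (r i powr \<delta>) \<partial>count_space UNIV) < ennreal b"
    by (rule content_lessE[OF assms(4)]) blast
  have "hausdorff_content D E \<le> (\<integral>\<^sup>+ i. ennreal (r i powr D) \<partial>count_space UNIV)"
    using * by (intro content_le_cover) auto
  also have "\<dots> \<le> ennreal (b powr (D / \<delta>))"
    using assms * by (intro sum_powr_le[where \<delta> = \<delta>]) auto
  finally show ?thesis .
qed

section \<open>Maximal function estimates\<close>

text \<open>
  If \<open>F j\<close> are the superlevel sets \<open>{g > 2 powr j}\<close> of a function \<open>g\<close>, then \<open>layer_sum D F B\<close> is
  comparable to the Choquet integral of \<open>g\<close> over \<open>B\<close> with respect to the \<open>D\<close>-dimensional content.
\<close>

abbreviation layer_sum :: "real \<Rightarrow> (int \<Rightarrow> 'a::metric_space set) \<Rightarrow> 'a set \<Rightarrow> ennreal" where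
  "layer_sum D F B \<equiv> (\<integral>\<^sup>+ j. ennreal (2 powr real_of_int j) * hausdorff_content D (F j \<inter> B) \<partial>count_space UNIV)"

text \<open>
  Restricted weak-type bound: the set where the maximal function of the indicator of \<open>F\<close>, with
  averages taken with respect to the \<open>D\<close>-dimensional content, exceeds \<open>s\<close>. Given a cover of \<open>F\<close>,
  the doubled balls of the cover handle the points for which a large ball of the cover meets
  \<open>ball x r\<close>. At the other points \<open>\<Sum>\<rho> powr D > s * r powr D\<close> over the balls with centre in
  \<open>cball x (2 * r)\<close>, hence \<open>\<Sum>\<rho> powr \<delta> \<ge> s powr (\<delta> / D) * r powr \<delta>\<close> over the same balls. Vitali
  selects disjoint balls \<open>cball x (2 * r)\<close>; each centre of the cover is then counted at most once,
  so no packing property of the content itself is needed.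
\<close>

lemma content_maximal_weak:
  fixes F :: "'a::euclidean_space set"
  assumes \<delta>: "0 < \<delta>" "\<delta> \<le> D" and s: "0 < s" "s \<le> 1"
  shows "hausdorff_content \<delta> {x. \<exists>r>0. hausdorff_content D (F \<inter> ball x r) > ennreal (s * r powr D)}
    \<le> ennreal ((2 powr \<delta> + 10 powr \<delta>) * s powr - (\<delta> / D)) * hausdorff_content \<delta> F"
proof (rule content_geI)
  show "0 < (2 powr \<delta> + 10 powr \<delta>) * s powr - (\<delta> / D)"
    using s by (simp add: add_pos_pos)
next
  fix c :: "nat \<Rightarrow> 'a" and \<rho> :: "nat \<Rightarrow> real"
  assume \<rho>: "\<And>i. 0 \<le> \<rho> i" and cov: "F \<subseteq> (\<Union>i. ball (c i) (\<rho> i))"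
  define S where "S = (\<integral>\<^sup>+ i. ennreal (\<rho> i powr \<delta>) \<partial>count_space UNIV)"
  define \<sigma> where "\<sigma> = s powr - (\<delta> / D)"
  have \<sigma>: "\<sigma> \<ge> 1"
    using s \<delta> powr_mono'[of "- (\<delta> / D)" 0 s] by (simp add: \<sigma>_def)
  define U where "U = {x. \<exists>r>0. hausdorff_content D (F \<inter> ball x r) > ennreal (s * r powr D)}"
  have "hausdorff_content \<delta> U \<le> ennreal ((2 powr \<delta> + 10 powr \<delta>) * \<sigma>) * S"
  proof (cases "S = top")
    case True
    have "(2 powr \<delta> + 10 powr \<delta>) * \<sigma> > 0"
      using \<sigma> by (simp add: add_pos_pos)
    then have "ennreal ((2 powr \<delta> + 10 powr \<delta>) * \<sigma>) \<noteq> 0"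
      by (simp only: ennreal_eq_0_iff not_le)
    then show ?thesis by (simp only: True ennreal_mult_top if_False top_greatest)
  next
    case False
    then obtain S' where S': "S = ennreal S'" "S' \<ge> 0" by (cases S) auto
    \<comment> \<open>\<open>A\<close> contains every \<open>x\<close> for which a ball of the cover of radius at least \<open>R x\<close> meets \<open>ball x (R x)\<close>\<close>
    define A where "A = (\<Union>i. ball (c i) (2 * \<rho> i))"
    define G where "G = U - A"
    have "\<forall>x\<in>U. \<exists>r>0. hausdorff_content D (F \<inter> ball x r) > ennreal (s * r powr D)"
      by (simp add: U_def)
    then obtain R where R: "\<And>x. x \<in> U \<Longrightarrow> R x > 0"
      "\<And>x. x \<in> U \<Longrightarrow> hausdorff_content D (F \<inter> ball x (R x)) > ennreal (s * R x powr D)"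
      by metis
    define I where "I x = {i. c i \<in> cball x (2 * R x)}" for x
    \<comment> \<open>off \<open>A\<close>, only small balls of the cover meet \<open>ball x (R x)\<close>, and their centres lie in \<open>cball x (2 * R x)\<close>\<close>
    have key: "ennreal (R x powr \<delta>) \<le> ennreal \<sigma> * (\<integral>\<^sup>+ i. ennreal (\<rho> i powr \<delta>) \<partial>count_space (I x))"
      if x: "x \<in> G" for x
    proof -
      define b where "b = s powr (\<delta> / D) * R x powr \<delta>"
      have Rx: "R x > 0" and big: "hausdorff_content D (F \<inter> ball x (R x)) > ennreal (s * R x powr D)"
        using R x by (auto simp: G_def)
      have "F \<inter> ball x (R x) \<subseteq> (\<Union>i\<in>I x. ball (c i) (\<rho> i))"
      proof
        fix y assume y: "y \<in> F \<inter> ball x (R x)"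
        then obtain i where i: "dist (c i) y < \<rho> i" using cov by auto
        have "\<not> dist (c i) x < 2 * \<rho> i" using x by (auto simp: G_def A_def)
        moreover have "dist (c i) x \<le> dist (c i) y + dist x y" by (rule dist_triangle2)
        ultimately have "dist (c i) x \<le> 2 * R x" using i y by auto
        then show "y \<in> (\<Union>i\<in>I x. ball (c i) (\<rho> i))"
          using i by (auto simp: I_def dist_commute)
      qed
      then have "hausdorff_content D (F \<inter> ball x (R x)) \<le> (\<integral>\<^sup>+ i. ennreal (\<rho> i powr D) \<partial>count_space (I x))"
        by (intro content_le_cover) (auto simp: \<rho>)
      with big have 1: "ennreal (s * R x powr D) < (\<integral>\<^sup>+ i. ennreal (\<rho> i powr D) \<partial>count_space (I x))"
        by (rule less_le_trans)
      have "ennreal b \<le> (\<integral>\<^sup>+ i. ennreal (\<rho> i powr \<delta>) \<partial>count_space (I x))"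
      proof (rule ccontr)
        assume "\<not> ennreal b \<le> (\<integral>\<^sup>+ i. ennreal (\<rho> i powr \<delta>) \<partial>count_space (I x))"
        then have "(\<integral>\<^sup>+ i. ennreal (\<rho> i powr D) \<partial>count_space (I x)) \<le> ennreal (b powr (D / \<delta>))"
          by (intro sum_powr_le[where \<delta> = \<delta>]) (auto simp: \<delta> \<rho> b_def)
        also have "b powr (D / \<delta>) = s * R x powr D"
          using \<delta> s Rx by (simp add: b_def powr_mult powr_powr)
        finally show False using 1 by simp
      qed
      then have "ennreal \<sigma> * ennreal b \<le> ennreal \<sigma> * (\<integral>\<^sup>+ i. ennreal (\<rho> i powr \<delta>) \<partial>count_space (I x))"
        by (rule mult_left_mono) simp
      moreover have "\<sigma> * b = R x powr \<delta>"
        using s by (simp add: \<sigma>_def b_def mult.assoc[symmetric] flip: powr_add)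
      moreover have "ennreal \<sigma> * ennreal b = ennreal (\<sigma> * b)"
        using \<sigma> by (intro ennreal_mult[symmetric]) (auto simp: b_def)
      ultimately show ?thesis by simp
    qed
    have sub: "(\<integral>\<^sup>+ i. ennreal (\<rho> i powr \<delta>) \<partial>count_space J) \<le> S" for J
      unfolding S_def by (subst nn_integral_count_space_indicator)
        (auto intro!: nn_integral_mono split: split_indicator)
    have bound: "R x \<le> (\<sigma> * S') powr (1 / \<delta>)" if "x \<in> G" for x
    proof -
      have "ennreal (R x powr \<delta>) \<le> ennreal \<sigma> * S"
        using key[OF that] mult_left_mono[OF sub, of "ennreal \<sigma>"] by (rule order_trans) simp
      then have "R x powr \<delta> \<le> \<sigma> * S'" using S' \<sigma> by (simp flip: ennreal_mult)
      then have "(R x powr \<delta>) powr (1 / \<delta>) \<le> (\<sigma> * S') powr (1 / \<delta>)"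
        using \<delta> by (intro powr_mono2) auto
      then show ?thesis using \<delta> R(1)[of x] that by (simp add: powr_powr G_def)
    qed
    have R2: "0 < 2 * R x \<and> 2 * R x \<le> 2 * (\<sigma> * S') powr (1 / \<delta>)" if "x \<in> G" for x
      using bound[OF that] R(1)[of x] that by (simp add: G_def)
    obtain C where C: "countable C" "C \<subseteq> G"
      "pairwise (\<lambda>x y. disjnt (cball x (2 * R x)) (cball y (2 * R y))) C"
      and CG: "\<And>x. x \<in> G \<Longrightarrow> \<exists>y. y \<in> C \<and> \<not> disjnt (cball x (2 * R x)) (cball y (2 * R y)) \<and>
                        cball x (2 * R x) \<subseteq> ball y (5 * (2 * R y))"
      by (rule Vitali_covering_lemma_cballs_balls[where a = "\<lambda>x. x", OF R2]) (assumption, rule that, assumption+)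
    have "hausdorff_content \<delta> G \<le> (\<integral>\<^sup>+ x. ennreal ((10 * R x) powr \<delta>) \<partial>count_space C)"
    proof (rule content_le_cover)
      show "G \<subseteq> (\<Union>x\<in>C. ball x (10 * R x))"
      proof
        fix x assume x: "x \<in> G"
        then have "x \<in> cball x (2 * R x)" using R(1)[of x] by (simp add: G_def)
        moreover obtain y where "y \<in> C" "cball x (2 * R x) \<subseteq> ball y (5 * (2 * R y))"
          using CG[OF x] by blast
        ultimately have "x \<in> ball y (5 * (2 * R y))" by blast
        with \<open>y \<in> C\<close> show "x \<in> (\<Union>x\<in>C. ball x (10 * R x))" by auto
      qed
      show "0 \<le> 10 * R x" if "x \<in> C" for x using R(1)[of x] that C by (auto simp: G_def)
    qed (rule C)
    also have "\<dots> \<le> (\<integral>\<^sup>+ x. ennreal (10 powr \<delta> * \<sigma>) * (\<integral>\<^sup>+ i. ennreal (\<rho> i powr \<delta>) * indicator (I x) i \<partial>count_space UNIV) \<partial>count_space C)"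
    proof (intro nn_integral_mono)
      fix x assume "x \<in> space (count_space C)"
      then have x: "x \<in> G" using C by auto
      have "ennreal ((10 * R x) powr \<delta>) = ennreal (10 powr \<delta>) * ennreal (R x powr \<delta>)"
        using R(1)[of x] x by (simp add: powr_mult G_def flip: ennreal_mult)
      also have "\<dots> \<le> ennreal (10 powr \<delta>) * (ennreal \<sigma> * (\<integral>\<^sup>+ i. ennreal (\<rho> i powr \<delta>) \<partial>count_space (I x)))"
        by (intro mult_left_mono key x) simp
      also have "\<dots> = ennreal (10 powr \<delta> * \<sigma>) * (\<integral>\<^sup>+ i. ennreal (\<rho> i powr \<delta>) * indicator (I x) i \<partial>count_space UNIV)"
        using \<sigma> by (subst nn_integral_count_space_indicator) (auto simp: ennreal_mult mult.assoc)
      finally show "ennreal ((10 * R x) powr \<delta>) \<le> \<dots>" .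
    qed
    also have "\<dots> = ennreal (10 powr \<delta> * \<sigma>) * (\<integral>\<^sup>+ i. \<integral>\<^sup>+ x. ennreal (\<rho> i powr \<delta>) * indicator (I x) i \<partial>count_space C \<partial>count_space UNIV)"
    proof -
      have "(\<integral>\<^sup>+ x. \<integral>\<^sup>+ i. ennreal (\<rho> i powr \<delta>) * indicator (I x) i \<partial>count_space UNIV \<partial>count_space C)
        = (\<integral>\<^sup>+ i. \<integral>\<^sup>+ x. ennreal (\<rho> i powr \<delta>) * indicator (I x) i \<partial>count_space C \<partial>count_space UNIV)"
        by (rule nn_integral_count_space_nn_integral) auto
      then show ?thesis by (simp add: nn_integral_cmult)
    qed
    also have "\<dots> \<le> ennreal (10 powr \<delta> * \<sigma>) * S"
      unfolding S_def
    proof (intro mult_left_mono nn_integral_mono)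
      fix i :: nat
      \<comment> \<open>by disjointness, \<open>c i\<close> lies in at most one of the selected balls\<close>
      show "(\<integral>\<^sup>+ x. ennreal (\<rho> i powr \<delta>) * indicator (I x) i \<partial>count_space C) \<le> ennreal (\<rho> i powr \<delta>)"
      proof (cases "\<exists>x\<in>C. i \<in> I x")
        case True
        then obtain x0 where x0: "x0 \<in> C" "i \<in> I x0" by auto
        have iff: "i \<in> I x \<longleftrightarrow> x = x0" if "x \<in> C" for x
          using C(3) that x0 unfolding pairwise_def I_def disjnt_iff by blast
        have "(\<integral>\<^sup>+ x. ennreal (\<rho> i powr \<delta>) * indicator (I x) i \<partial>count_space C)
            = (\<integral>\<^sup>+ x. ennreal (\<rho> i powr \<delta>) * indicator {x0} x \<partial>count_space C)"
          by (intro nn_integral_cong) (simp add: indicator_def iff)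
        also have "\<dots> = ennreal (\<rho> i powr \<delta>)"
          using x0 by simp
        finally show ?thesis by simp
      next
        case False
        then have "(\<integral>\<^sup>+ x. ennreal (\<rho> i powr \<delta>) * indicator (I x) i \<partial>count_space C) = (\<integral>\<^sup>+ x. 0 \<partial>count_space C)"
          by (intro nn_integral_cong) (auto split: split_indicator)
        then show ?thesis by simp
      qed
    qed simp
    finally have hG: "hausdorff_content \<delta> G \<le> ennreal (10 powr \<delta> * \<sigma>) * S" .
    have "hausdorff_content \<delta> A \<le> (\<integral>\<^sup>+ i. ennreal ((2 * \<rho> i) powr \<delta>) \<partial>count_space UNIV)"
      unfolding A_def by (rule content_le_cover) (auto simp: \<rho>)
    also have "\<dots> = ennreal (2 powr \<delta>) * S"
      unfolding S_def by (simp add: nn_integral_cmult[symmetric] powr_mult \<rho> ennreal_mult)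
    also have "\<dots> \<le> ennreal (2 powr \<delta> * \<sigma>) * S"
      using \<sigma> by (intro mult_right_mono ennreal_leI) auto
    finally have hA: "hausdorff_content \<delta> A \<le> ennreal (2 powr \<delta> * \<sigma>) * S" .
    have "hausdorff_content \<delta> U \<le> hausdorff_content \<delta> (A \<union> G)"
      by (rule content_mono) (auto simp: G_def)
    also have "\<dots> \<le> hausdorff_content \<delta> A + hausdorff_content \<delta> G" by (rule content_Un_le)
    also have "\<dots> \<le> ennreal (2 powr \<delta> * \<sigma>) * S + ennreal (10 powr \<delta> * \<sigma>) * S"
      by (rule add_mono[OF hA hG])
    also have "\<dots> = ennreal ((2 powr \<delta> + 10 powr \<delta>) * \<sigma>) * S"
      using \<sigma> by (simp add: distrib_right ennreal_plus)
    finally show ?thesis .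
  qed
  then show "hausdorff_content \<delta> {x. \<exists>r>0. hausdorff_content D (F \<inter> ball x r) > ennreal (s * r powr D)}
    \<le> ennreal ((2 powr \<delta> + 10 powr \<delta>) * s powr - (\<delta> / D)) * (\<integral>\<^sup>+ i. ennreal (\<rho> i powr \<delta>) \<partial>count_space UNIV)"
    by (simp only: U_def S_def \<sigma>_def)
qed

text \<open>
  The strong-type bound for the maximal function of a layered function, for exponents above
  \<open>\<delta> / D\<close>. The content is not used as an additive set function: if the layers together exceed
  \<open>2 powr i\<close> on average, then some single layer \<open>j\<close> exceeds a share proportional to
  \<open>2 powr (- \<eta> * \<bar>i - j\<bar>)\<close>. The sets on which this happens are controlled by the restricted
  weak-type bound, and \<open>\<eta>\<close> is so small that the resulting double sum over \<open>i\<close> and \<open>j\<close> still decays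
  geometrically away from the diagonal.
\<close>

lemma layered_maximal_strong:
  fixes \<delta> D p :: real
  assumes \<delta>: "0 < \<delta>" "\<delta> \<le> D" and p: "\<delta> / D < p"
  shows "\<exists>C>0. \<forall>F :: int \<Rightarrow> 'a::euclidean_space set.
    (\<integral>\<^sup>+ i. ennreal (2 powr (p * real_of_int i)) * hausdorff_content \<delta>
        {x. \<exists>r>0. layer_sum D F (ball x r)
              > ennreal (2 powr real_of_int i * r powr D)} \<partial>count_space UNIV)
    \<le> ennreal C * (\<integral>\<^sup>+ j. ennreal (2 powr (p * real_of_int j)) * hausdorff_content \<delta> (F j) \<partial>count_space UNIV)"
proof -
  define p0 where "p0 = \<delta> / D"
  have p0: "0 < p0" "p0 < p" using \<delta> p by (auto simp: p0_def)
  define \<eta> where "\<eta> = min (1 / 2) ((p / p0 - 1) / 2)"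
  define \<epsilon> where "\<epsilon> = (p - p0) / 2"
  \<comment> \<open>for \<open>s \<le> 1\<close> the exponent \<open>p0\<close> may be raised to \<open>\<Theta>\<close>, which gives decay for \<open>i > j\<close>\<close>
  define \<Theta> where "\<Theta> = 2 * (p + \<epsilon>)"
  have \<eta>: "0 < \<eta>" "\<eta> \<le> 1 / 2" using p0 by (auto simp: \<eta>_def field_simps)
  have "\<eta> * p0 \<le> (p / p0 - 1) / 2 * p0"
    unfolding \<eta>_def using p0 by (intro mult_right_mono min.cobounded2) auto
  also have "\<dots> = \<epsilon>" using p0 by (simp add: \<epsilon>_def field_simps)
  finally have "p0 + \<eta> * p0 \<le> p0 + \<epsilon>" by simp
  also have "p0 + \<epsilon> = p - \<epsilon>" by (simp add: \<epsilon>_def field_simps)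
  finally have \<eta>p0: "(1 + \<eta>) * p0 \<le> p - \<epsilon>" by (simp add: distrib_right)
  have \<epsilon>: "0 < \<epsilon>" using p0 by (simp add: \<epsilon>_def)
  then have \<Theta>: "p0 \<le> \<Theta>" using p0 by (simp add: \<Theta>_def)
  have \<eta>\<Theta>: "p + \<epsilon> \<le> (1 - \<eta>) * \<Theta>"
  proof -
    have "1 / 2 * \<Theta> \<le> (1 - \<eta>) * \<Theta>" using \<eta> \<Theta> p0 by (intro mult_right_mono) auto
    then show ?thesis by (simp add: \<Theta>_def)
  qed
  define G where "G = geom_const \<eta>"
  have G: "G \<ge> 1" unfolding G_def by (rule geom_const_ge_1[OF \<eta>(1)])
  define \<kappa> where "\<kappa> = 2 powr \<delta> + 10 powr \<delta>"
  have \<kappa>: "\<kappa> > 0" by (simp add: \<kappa>_def add_pos_pos)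
  define s where "s i j = 2 powr (real_of_int i - real_of_int j - \<eta> * \<bar>real_of_int j - real_of_int i\<bar>) / G" for i j :: int
  have s_pos: "s i j > 0" for i j using G by (simp add: s_def)
  have s_neg: "s i j powr - a = G powr a * 2 powr (- a * (real_of_int i - real_of_int j - \<eta> * \<bar>real_of_int j - real_of_int i\<bar>))" for i j a
  proof -
    define e where "e = real_of_int i - real_of_int j - \<eta> * \<bar>real_of_int j - real_of_int i\<bar>"
    have "s i j powr - a = (2 powr e) powr - a / G powr - a"
      using G by (simp add: s_def e_def powr_divide)
    also have "\<dots> = G powr a * 2 powr (- a * e)"
      by (simp only: powr_powr powr_minus[of G] mult.commute[of e]) (simp add: field_simps)
    finally show ?thesis by (simp only: e_def)
  qed
  have s_powr: "s i j powr - p0 \<le> G powr \<Theta> * 2 powr (p * (real_of_int j - real_of_int i) - \<epsilon> * \<bar>real_of_int i - real_of_int j\<bar>)"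
    if "s i j \<le> 1" for i j
  proof (cases "i \<le> j")
    case True
    have "s i j powr - p0 = G powr p0 * 2 powr (((1 + \<eta>) * p0) * (real_of_int j - real_of_int i))"
      using True by (simp add: s_neg) (simp add: algebra_simps)
    also have "\<dots> \<le> G powr \<Theta> * 2 powr ((p - \<epsilon>) * (real_of_int j - real_of_int i))"
      using True G \<Theta> \<eta>p0 by (intro mult_mono powr_mono mult_right_mono) auto
    finally show ?thesis using True by (simp add: algebra_simps)
  next
    case False
    have "s i j powr - p0 \<le> s i j powr - \<Theta>"
      using that s_pos[of i j] \<Theta> by (intro powr_mono') auto
    also have "\<dots> = G powr \<Theta> * 2 powr (- ((1 - \<eta>) * \<Theta>) * (real_of_int i - real_of_int j))"
      using False by (simp add: s_neg) (simp add: algebra_simps)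
    also have "\<dots> \<le> G powr \<Theta> * 2 powr (- (p + \<epsilon>) * (real_of_int i - real_of_int j))"
      using False \<eta>\<Theta> by (intro mult_left_mono powr_mono mult_right_mono) auto
    finally show ?thesis using False by (simp add: algebra_simps)
  qed
  define C where "C = \<kappa> * G powr \<Theta> * geom_const \<epsilon>"
  have G\<epsilon>: "geom_const \<epsilon> \<ge> 1" by (rule geom_const_ge_1[OF \<epsilon>])
  show ?thesis
  proof (intro exI[of _ C] conjI allI)
    show "C > 0" using \<kappa> G G\<epsilon> by (simp add: C_def)
  next
    fix F :: "int \<Rightarrow> 'a set"
    define U where "U i = {x. \<exists>r>0. layer_sum D F (ball x r)
              > ennreal (2 powr real_of_int i * r powr D)}" for i :: int
    define V where "V i j = {x. \<exists>r>0. hausdorff_content D (F j \<inter> ball x r) > ennreal (s i j * r powr D)}" for i j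
    \<comment> \<open>if no layer exceeded its share, the shares, which add up to 1, would bound the whole sum\<close>
    have UV: "U i \<subseteq> (\<Union>j. V i j)" for i
    proof (rule subsetI, rule ccontr)
      fix x assume "x \<in> U i" and n: "x \<notin> (\<Union>j. V i j)"
      then obtain r where r: "r > 0"
        and big: "layer_sum D F (ball x r)
              > ennreal (2 powr real_of_int i * r powr D)" by (auto simp: U_def)
      have small: "hausdorff_content D (F j \<inter> ball x r) \<le> ennreal (s i j * r powr D)" for j
        using n r unfolding V_def not_less[symmetric] by blast
      have "layer_sum D F (ball x r)
        \<le> (\<integral>\<^sup>+ j. ennreal (2 powr real_of_int i * r powr D / G) * ennreal (2 powr (- \<eta> * \<bar>real_of_int j - real_of_int i\<bar>)) \<partial>count_space UNIV)"
      proof (intro nn_integral_mono)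
        fix j :: int
        have "ennreal (2 powr real_of_int j) * hausdorff_content D (F j \<inter> ball x r)
            \<le> ennreal (2 powr real_of_int j) * ennreal (s i j * r powr D)"
          by (intro mult_left_mono small) simp
        also have "\<dots> = ennreal (2 powr real_of_int j * (s i j * r powr D))"
          using s_pos[of i j] by (subst ennreal_mult) auto
        also have "2 powr real_of_int j * (s i j * r powr D)
            = 2 powr real_of_int i * r powr D / G * 2 powr (- \<eta> * \<bar>real_of_int j - real_of_int i\<bar>)"
        proof -
          have "2 powr real_of_int j * 2 powr (real_of_int i - real_of_int j - \<eta> * \<bar>real_of_int j - real_of_int i\<bar>)
            = 2 powr real_of_int i * 2 powr (- \<eta> * \<bar>real_of_int j - real_of_int i\<bar>)"
            unfolding powr_add[symmetric] by simp
          then show ?thesis unfolding s_def by (simp add: mult_ac)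
        qed
        also have "ennreal \<dots> = ennreal (2 powr real_of_int i * r powr D / G) * ennreal (2 powr (- \<eta> * \<bar>real_of_int j - real_of_int i\<bar>))"
          using G by (intro ennreal_mult) auto
        finally show "ennreal (2 powr real_of_int j) * hausdorff_content D (F j \<inter> ball x r) \<le> \<dots>" .
      qed
      also have "\<dots> = ennreal (2 powr real_of_int i * r powr D / G) * ennreal G"
        unfolding G_def by (subst nn_integral_cmult) (simp_all only: geom_sum_int_shift[OF \<eta>(1)] measurable_count_space_eq1, auto)
      also have "\<dots> = ennreal (2 powr real_of_int i * r powr D)"
        using G by (simp flip: ennreal_mult)
      finally show False using big by simp
    qed
    have hV: "hausdorff_content \<delta> (V i j) \<le> ennreal (\<kappa> * (G powr \<Theta> * 2 powr (p * (real_of_int j - real_of_int i) - \<epsilon> * \<bar>real_of_int i - real_of_int j\<bar>)))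
        * hausdorff_content \<delta> (F j)" for i j
    proof (cases "s i j \<le> 1")
      case True
      have "hausdorff_content \<delta> (V i j) \<le> ennreal (\<kappa> * s i j powr - p0) * hausdorff_content \<delta> (F j)"
        unfolding V_def \<kappa>_def p0_def by (rule content_maximal_weak[OF \<delta> s_pos True])
      also have "\<dots> \<le> ennreal (\<kappa> * (G powr \<Theta> * 2 powr (p * (real_of_int j - real_of_int i) - \<epsilon> * \<bar>real_of_int i - real_of_int j\<bar>)))
        * hausdorff_content \<delta> (F j)"
        using \<kappa> s_powr[OF True] by (intro mult_right_mono ennreal_leI mult_left_mono) auto
      finally show ?thesis .
    next
      case False
      \<comment> \<open>averages of an indicator never exceed 1\<close>
      have "V i j = {}"
      proof (rule ccontr)
        assume "V i j \<noteq> {}"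
        then obtain x r where r: "r > 0" "hausdorff_content D (F j \<inter> ball x r) > ennreal (s i j * r powr D)"
          by (auto simp: V_def)
        have "hausdorff_content D (F j \<inter> ball x r) \<le> hausdorff_content D (ball x r)" by (rule content_mono) auto
        also have "\<dots> \<le> ennreal (r powr D)" using r by (intro content_ball_le) auto
        also have "\<dots> \<le> ennreal (s i j * r powr D)" using False by (intro ennreal_leI) (simp add: mult_le_cancel_right1)
        finally show False using r by simp
      qed
      then show ?thesis by simp
    qed
    have "(\<integral>\<^sup>+ i. ennreal (2 powr (p * real_of_int i)) * hausdorff_content \<delta> (U i) \<partial>count_space UNIV)
      \<le> (\<integral>\<^sup>+ i. \<integral>\<^sup>+ j. ennreal (\<kappa> * G powr \<Theta> * 2 powr (p * real_of_int j)) * hausdorff_content \<delta> (F j)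
            * ennreal (2 powr (- \<epsilon> * \<bar>real_of_int i - real_of_int j\<bar>)) \<partial>count_space UNIV \<partial>count_space UNIV)"
    proof (intro nn_integral_mono)
      fix i :: int
      have "hausdorff_content \<delta> (U i) \<le> (\<integral>\<^sup>+ j. hausdorff_content \<delta> (V i j) \<partial>count_space UNIV)"
        using content_mono[OF UV] content_countable_subadd by (rule order_trans)
      also have "\<dots> \<le> (\<integral>\<^sup>+ j. ennreal (\<kappa> * (G powr \<Theta> * 2 powr (p * (real_of_int j - real_of_int i) - \<epsilon> * \<bar>real_of_int i - real_of_int j\<bar>)))
        * hausdorff_content \<delta> (F j) \<partial>count_space UNIV)"
        by (intro nn_integral_mono hV)
      finally have "ennreal (2 powr (p * real_of_int i)) * hausdorff_content \<delta> (U i)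
        \<le> ennreal (2 powr (p * real_of_int i)) * \<dots>" by (rule mult_left_mono) simp
      also have "\<dots> = (\<integral>\<^sup>+ j. ennreal (2 powr (p * real_of_int i)) * (ennreal (\<kappa> * (G powr \<Theta> * 2 powr (p * (real_of_int j - real_of_int i) - \<epsilon> * \<bar>real_of_int i - real_of_int j\<bar>)))
        * hausdorff_content \<delta> (F j)) \<partial>count_space UNIV)"
        by (rule nn_integral_cmult[symmetric]) simp
      also have "\<dots> = (\<integral>\<^sup>+ j. ennreal (\<kappa> * G powr \<Theta> * 2 powr (p * real_of_int j)) * hausdorff_content \<delta> (F j)
            * ennreal (2 powr (- \<epsilon> * \<bar>real_of_int i - real_of_int j\<bar>)) \<partial>count_space UNIV)"
      proof (intro nn_integral_cong)
        fix j :: int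
        have "2 powr (p * real_of_int i) * 2 powr (p * (real_of_int j - real_of_int i) - \<epsilon> * \<bar>real_of_int i - real_of_int j\<bar>)
          = 2 powr (p * real_of_int j) * 2 powr (- \<epsilon> * \<bar>real_of_int i - real_of_int j\<bar>)"
          unfolding powr_add[symmetric] by (simp add: algebra_simps)
        then have "2 powr (p * real_of_int i) * (\<kappa> * (G powr \<Theta> * 2 powr (p * (real_of_int j - real_of_int i) - \<epsilon> * \<bar>real_of_int i - real_of_int j\<bar>)))
          = \<kappa> * G powr \<Theta> * 2 powr (p * real_of_int j) * 2 powr (- \<epsilon> * \<bar>real_of_int i - real_of_int j\<bar>)"
          by (simp add: mult_ac)
        then have "ennreal (2 powr (p * real_of_int i)) * ennreal (\<kappa> * (G powr \<Theta> * 2 powr (p * (real_of_int j - real_of_int i) - \<epsilon> * \<bar>real_of_int i - real_of_int j\<bar>)))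
          = ennreal (\<kappa> * G powr \<Theta> * 2 powr (p * real_of_int j)) * ennreal (2 powr (- \<epsilon> * \<bar>real_of_int i - real_of_int j\<bar>))"
          using \<kappa> by (simp flip: ennreal_mult)
        then show "ennreal (2 powr (p * real_of_int i)) * (ennreal (\<kappa> * (G powr \<Theta> * 2 powr (p * (real_of_int j - real_of_int i) - \<epsilon> * \<bar>real_of_int i - real_of_int j\<bar>)))
        * hausdorff_content \<delta> (F j)) = ennreal (\<kappa> * G powr \<Theta> * 2 powr (p * real_of_int j)) * hausdorff_content \<delta> (F j)
            * ennreal (2 powr (- \<epsilon> * \<bar>real_of_int i - real_of_int j\<bar>))"
          by (simp only: mult.assoc[symmetric]) (simp only: mult_ac)
      qed
      finally show "ennreal (2 powr (p * real_of_int i)) * hausdorff_content \<delta> (U i) \<le> \<dots>" .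
    qed
    also have "\<dots> = (\<integral>\<^sup>+ j. \<integral>\<^sup>+ i. ennreal (\<kappa> * G powr \<Theta> * 2 powr (p * real_of_int j)) * hausdorff_content \<delta> (F j)
            * ennreal (2 powr (- \<epsilon> * \<bar>real_of_int i - real_of_int j\<bar>)) \<partial>count_space UNIV \<partial>count_space UNIV)"
      by (rule nn_integral_count_space_nn_integral) auto
    also have "\<dots> = (\<integral>\<^sup>+ j. ennreal (\<kappa> * G powr \<Theta> * 2 powr (p * real_of_int j)) * hausdorff_content \<delta> (F j) * ennreal (geom_const \<epsilon>) \<partial>count_space UNIV)"
      by (intro nn_integral_cong) (subst nn_integral_cmult, simp, simp only: geom_sum_int_shift[OF \<epsilon>])
    also have "\<dots> = (\<integral>\<^sup>+ j. ennreal C * (ennreal (2 powr (p * real_of_int j)) * hausdorff_content \<delta> (F j)) \<partial>count_space UNIV)"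
    proof (intro nn_integral_cong)
      fix j :: int
      have "ennreal (\<kappa> * G powr \<Theta> * 2 powr (p * real_of_int j)) * ennreal (geom_const \<epsilon>) = ennreal C * ennreal (2 powr (p * real_of_int j))"
        unfolding C_def using \<kappa> G\<epsilon> by (simp add: mult_ac flip: ennreal_mult)
      then show "ennreal (\<kappa> * G powr \<Theta> * 2 powr (p * real_of_int j)) * hausdorff_content \<delta> (F j) * ennreal (geom_const \<epsilon>)
        = ennreal C * (ennreal (2 powr (p * real_of_int j)) * hausdorff_content \<delta> (F j))"
        by (metis mult.assoc mult.commute)
    qed
    also have "\<dots> = ennreal C * (\<integral>\<^sup>+ j. ennreal (2 powr (p * real_of_int j)) * hausdorff_content \<delta> (F j) \<partial>count_space UNIV)"
      by (rule nn_integral_cmult) simp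
    finally show "(\<integral>\<^sup>+ i. ennreal (2 powr (p * real_of_int i)) * hausdorff_content \<delta>
        {x. \<exists>r>0. layer_sum D F (ball x r)
              > ennreal (2 powr real_of_int i * r powr D)} \<partial>count_space UNIV)
    \<le> ennreal C * (\<integral>\<^sup>+ j. ennreal (2 powr (p * real_of_int j)) * hausdorff_content \<delta> (F j) \<partial>count_space UNIV)"
      by (simp only: U_def)
  qed
qed

section \<open>Hedberg's inequality\<close>

text \<open>
  The dyadic form of the Riesz potential is bounded by a power of a bound \<open>T\<close> for the maximal
  function times a power of a bound \<open>B\<close> for the \<open>p\<close>-th power of the weak-type norm. The latter gives
  \<open>layer_sum D F (ball x r) \<le> C * B powr (1 / p) * r powr (D - \<delta> / p)\<close>, which is the better bound
  for large \<open>r\<close>, while \<open>T * r powr D\<close> is the better one for small \<open>r\<close>.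
\<close>

lemma hedberg_dyadic:
  fixes \<delta> D \<alpha> p :: real
  assumes \<delta>: "0 < \<delta>" "\<delta> \<le> D" and \<alpha>: "0 < \<alpha>" and p: "\<delta> / D < p" "p < \<delta> / \<alpha>"
  shows "\<exists>C>0. \<forall>(F :: int \<Rightarrow> 'a::metric_space set) x B T. B > 0 \<longrightarrow> T > 0 \<longrightarrow>
    (\<forall>j. hausdorff_content \<delta> (F j) < ennreal (B * 2 powr (- p * real_of_int j))) \<longrightarrow>
    (\<forall>k. layer_sum D F (ball x (2 powr real_of_int k))
        \<le> ennreal (T * 2 powr (D * real_of_int k))) \<longrightarrow>
    (\<integral>\<^sup>+ k. ennreal (2 powr ((\<alpha> - D) * real_of_int k)) *
       layer_sum D F (ball x (2 powr real_of_int k)) \<partial>count_space (UNIV :: int set))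
    \<le> ennreal (C * B powr (\<alpha> / \<delta>) * T powr (1 - \<alpha> * p / \<delta>))"
proof -
  have D: "D > 0" and p0: "p > 0" using \<delta> p by (auto intro: less_trans[of 0 "\<delta> / D"])
  define b where "b = p * D / \<delta> - 1"
  have b: "b > 0" using \<delta> p D by (simp add: b_def field_simps)
  define C1 where "C1 = 2 powr min 1 b * geom_const (min 1 b)"
  have C1: "C1 > 0" using b geom_const_ge_1[of "min 1 b"] by (simp add: C1_def)
  define b2 where "b2 = \<delta> / p - \<alpha>"
  have b2: "b2 > 0" using \<alpha> p p0 by (simp add: b2_def field_simps)
  define C2 where "C2 = 2 powr min \<alpha> b2 * geom_const (min \<alpha> b2)"
  have C2: "C2 > 0" using \<alpha> b2 geom_const_ge_1[of "min \<alpha> b2"] by (simp add: C2_def)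
  show ?thesis
  proof (intro exI[of _ "C2 * C1 powr (\<alpha> * p / \<delta>)"] conjI allI impI)
    show "C2 * C1 powr (\<alpha> * p / \<delta>) > 0" using C1 C2 by simp
  next
    fix F :: "int \<Rightarrow> 'a set" and x B T
    assume B: "B > 0" and T: "T > 0"
      and F: "\<forall>j. hausdorff_content \<delta> (F j) < ennreal (B * 2 powr (- p * real_of_int j))"
      and ST: "\<forall>k. layer_sum D F (ball x (2 powr real_of_int k))
        \<le> ennreal (T * 2 powr (D * real_of_int k))"
    define S where "S k = layer_sum D F (ball x (2 powr real_of_int k))" for k :: int
    have S: "S k \<le> ennreal (C1 * B powr (1 / p) * 2 powr ((D - \<delta> / p) * real_of_int k))" for k
    proof -
      have "S k \<le> (\<integral>\<^sup>+ j. ennreal (min (2 powr (D * real_of_int k) * 2 powr (1 * real_of_int j)) (B powr (D / \<delta>) * 2 powr (- b * real_of_int j))) \<partial>count_space (UNIV :: int set))"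
        unfolding S_def
      proof (intro nn_integral_mono)
        fix j :: int
        have "hausdorff_content D (F j \<inter> ball x (2 powr real_of_int k)) \<le> hausdorff_content D (ball x (2 powr real_of_int k))"
          by (rule content_mono) auto
        also have "\<dots> \<le> ennreal ((2 powr real_of_int k) powr D)" by (rule content_ball_le) simp
        also have "(2 powr real_of_int k) powr D = 2 powr (D * real_of_int k)" by (simp add: powr_powr mult.commute)
        finally have 1: "hausdorff_content D (F j \<inter> ball x (2 powr real_of_int k)) \<le> ennreal (2 powr (D * real_of_int k))" .
        have "hausdorff_content D (F j \<inter> ball x (2 powr real_of_int k)) \<le> hausdorff_content D (F j)"
          by (rule content_mono) auto
        also have "\<dots> \<le> ennreal ((B * 2 powr (- p * real_of_int j)) powr (D / \<delta>))"
          using F B \<delta> by (intro content_higher_exponent_le) auto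
        finally have 2: "hausdorff_content D (F j \<inter> ball x (2 powr real_of_int k)) \<le> \<dots>" .
        have "ennreal (2 powr real_of_int j) * hausdorff_content D (F j \<inter> ball x (2 powr real_of_int k))
          \<le> ennreal (2 powr real_of_int j) * ennreal (min (2 powr (D * real_of_int k)) ((B * 2 powr (- p * real_of_int j)) powr (D / \<delta>)))"
          using 1 2 by (intro mult_left_mono) (auto simp: min_def)
        also have "\<dots> = ennreal (2 powr real_of_int j * min (2 powr (D * real_of_int k)) ((B * 2 powr (- p * real_of_int j)) powr (D / \<delta>)))"
          by (subst ennreal_mult) auto
        also have "2 powr real_of_int j * min (2 powr (D * real_of_int k)) ((B * 2 powr (- p * real_of_int j)) powr (D / \<delta>))
          = min (2 powr (D * real_of_int k) * 2 powr (1 * real_of_int j)) (B powr (D / \<delta>) * 2 powr (- b * real_of_int j))"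
        proof -
          have "2 powr real_of_int j * (B * 2 powr (- p * real_of_int j)) powr (D / \<delta>)
            = B powr (D / \<delta>) * (2 powr real_of_int j * 2 powr (- p * real_of_int j * (D / \<delta>)))"
            using B by (simp add: powr_mult powr_powr)
          also have "\<dots> = B powr (D / \<delta>) * 2 powr (- b * real_of_int j)"
            unfolding powr_add[symmetric] by (simp add: b_def algebra_simps)
          finally show ?thesis by (simp add: min_mult_distrib_left mult.commute)
        qed
        finally show "ennreal (2 powr real_of_int j) * hausdorff_content D (F j \<inter> ball x (2 powr real_of_int k)) \<le> ennreal \<dots>" .
      qed
      also have "\<dots> \<le> ennreal (C1 * ((2 powr (D * real_of_int k)) powr (b / (1 + b)) * (B powr (D / \<delta>)) powr (1 / (1 + b))))"
        unfolding C1_def using b B by (intro two_sided_geom_sum) auto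
      also have "(B powr (D / \<delta>)) powr (1 / (1 + b)) = B powr (1 / p)"
        using B \<delta> D by (simp add: powr_powr b_def)
      also have "(2 powr (D * real_of_int k)) powr (b / (1 + b)) = 2 powr ((D - \<delta> / p) * real_of_int k)"
      proof -
        have "D * (b / (1 + b)) = D - \<delta> / p" using \<delta> D p0 by (simp add: b_def field_simps)
        then show ?thesis by (simp add: powr_powr) (metis mult.commute mult.assoc times_divide_eq_right)
      qed
      finally show ?thesis by (simp only: mult_ac)
    qed
    have "(\<integral>\<^sup>+ k. ennreal (2 powr ((\<alpha> - D) * real_of_int k)) * S k \<partial>count_space UNIV)
      \<le> (\<integral>\<^sup>+ k. ennreal (min (T * 2 powr (\<alpha> * real_of_int k)) (C1 * B powr (1 / p) * 2 powr (- b2 * real_of_int k))) \<partial>count_space (UNIV :: int set))"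
    proof (intro nn_integral_mono)
      fix k :: int
      define w where "w = 2 powr ((\<alpha> - D) * real_of_int k)"
      have "ennreal w * S k \<le> ennreal w * ennreal (min (T * 2 powr (D * real_of_int k)) (C1 * B powr (1 / p) * 2 powr ((D - \<delta> / p) * real_of_int k)))"
        using S[of k] ST[rule_format, of k] by (intro mult_left_mono) (auto simp: min_def S_def)
      also have "\<dots> = ennreal (w * min (T * 2 powr (D * real_of_int k)) (C1 * B powr (1 / p) * 2 powr ((D - \<delta> / p) * real_of_int k)))"
        using T C1 by (subst ennreal_mult) (auto simp: w_def)
      also have "w * min (T * 2 powr (D * real_of_int k)) (C1 * B powr (1 / p) * 2 powr ((D - \<delta> / p) * real_of_int k))
        = min (T * (w * 2 powr (D * real_of_int k))) (C1 * B powr (1 / p) * (w * 2 powr ((D - \<delta> / p) * real_of_int k)))"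
        by (simp add: min_mult_distrib_left w_def mult_ac)
      also have "w * 2 powr (D * real_of_int k) = 2 powr (\<alpha> * real_of_int k)"
        unfolding w_def powr_add[symmetric] by (simp add: algebra_simps)
      also have "w * 2 powr ((D - \<delta> / p) * real_of_int k) = 2 powr (- b2 * real_of_int k)"
        unfolding w_def b2_def powr_add[symmetric] by (simp add: algebra_simps)
      finally show "ennreal (2 powr ((\<alpha> - D) * real_of_int k)) * S k
        \<le> ennreal (min (T * 2 powr (\<alpha> * real_of_int k)) (C1 * B powr (1 / p) * 2 powr (- b2 * real_of_int k)))"
        by (simp only: w_def)
    qed
    also have "\<dots> \<le> ennreal (C2 * (T powr (b2 / (\<alpha> + b2)) * (C1 * B powr (1 / p)) powr (\<alpha> / (\<alpha> + b2))))"
      unfolding C2_def using \<alpha> b2 T B C1 by (intro two_sided_geom_sum) auto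
    also have "b2 / (\<alpha> + b2) = 1 - \<alpha> * p / \<delta>" using \<delta> p0 by (simp add: b2_def field_simps)
    also have "\<alpha> / (\<alpha> + b2) = \<alpha> * p / \<delta>" by (simp add: b2_def)
    also have "(C1 * B powr (1 / p)) powr (\<alpha> * p / \<delta>) = C1 powr (\<alpha> * p / \<delta>) * B powr (\<alpha> / \<delta>)"
      using C1 B p0 by (simp add: powr_mult powr_powr)
    finally show "(\<integral>\<^sup>+ k. ennreal (2 powr ((\<alpha> - D) * real_of_int k)) *
       layer_sum D F (ball x (2 powr real_of_int k)) \<partial>count_space (UNIV :: int set))
    \<le> ennreal (C2 * C1 powr (\<alpha> * p / \<delta>) * B powr (\<alpha> / \<delta>) * T powr (1 - \<alpha> * p / \<delta>))"
      by (simp only: S_def mult_ac)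
  qed
qed

section \<open>Dyadic discretization of the Choquet integral\<close>

lemma dyadic_index_floor:
  fixes p t :: real
  assumes "p > 0" "t > 0"
  obtains i :: int where "2 powr (p * real_of_int i) \<le> t" "t < 2 powr (p * (real_of_int i + 1))"
proof
  define i where "i = \<lfloor>log 2 t / p\<rfloor>"
  have "real_of_int i \<le> log 2 t / p" "log 2 t / p < real_of_int i + 1" unfolding i_def by linarith+
  then have "p * real_of_int i \<le> log 2 t" "log 2 t < p * (real_of_int i + 1)"
    using assms by (auto simp: field_simps)
  then show "2 powr (p * real_of_int i) \<le> t" "t < 2 powr (p * (real_of_int i + 1))"
    using assms by (auto simp: le_log_iff log_less_iff)
qed

lemma dyadic_index_ceiling:
  fixes p t :: real
  assumes "p > 0" "t > 0"
  obtains i :: int where "2 powr (p * (real_of_int i - 1)) < t" "t \<le> 2 powr (p * real_of_int i)"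
proof
  define i where "i = \<lceil>log 2 t / p\<rceil>"
  have "real_of_int i - 1 < log 2 t / p" "log 2 t / p \<le> real_of_int i" unfolding i_def by linarith+
  then have "p * (real_of_int i - 1) < log 2 t" "log 2 t \<le> p * real_of_int i"
    using assms by (auto simp: field_simps)
  then show "2 powr (p * (real_of_int i - 1)) < t" "t \<le> 2 powr (p * real_of_int i)"
    using assms by (auto simp: less_log_iff log_le_iff)
qed

text \<open>
  The scale \<open>K\<close> is free, so that the bound can be applied to a function that is only known to be
  at most a constant multiple of a power of another.
\<close>

lemma choquet_le_dyadic_sum:
  fixes g :: "'a::metric_space \<Rightarrow> ennreal"
  assumes "K > 0" "p > 0"
  shows "choquet_integral \<delta> UNIV g \<le>
    (\<integral>\<^sup>+ i. ennreal (K * 2 powr (p * (real_of_int i + 1))) * hausdorff_content \<delta> {x. g x > ennreal (K * 2 powr (p * real_of_int i))} \<partial>count_space (UNIV :: int set))"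
proof -
  define H where "H i = hausdorff_content \<delta> {x. g x > ennreal (K * 2 powr (p * real_of_int i))}" for i :: int
  define b where "b i = K * 2 powr (p * (real_of_int i + 1))" for i :: int
  have "choquet_integral \<delta> UNIV g \<le> (\<integral>\<^sup>+ t. \<integral>\<^sup>+ i. H i * indicator {0<..b i} t \<partial>count_space UNIV \<partial>lborel)"
    unfolding choquet_integral_def
  proof (intro nn_integral_mono)
    fix t :: real
    show "hausdorff_content \<delta> {x \<in> UNIV. g x > ennreal t} * indicator {0<..} t \<le> (\<integral>\<^sup>+ i. H i * indicator {0<..b i} t \<partial>count_space UNIV)"
    proof (cases "t > 0")
      case True
      obtain i :: int where i: "2 powr (p * real_of_int i) \<le> t / K" "t / K < 2 powr (p * (real_of_int i + 1))"
        using dyadic_index_floor[of p "t / K"] True assms by auto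
      have "hausdorff_content \<delta> {x \<in> UNIV. g x > ennreal t} \<le> H i"
        unfolding H_def
      proof (rule content_mono, clarsimp)
        fix x assume "ennreal t < g x"
        moreover have "ennreal (K * 2 powr (p * real_of_int i)) \<le> ennreal t"
          using i assms by (intro ennreal_leI) (simp add: field_simps)
        ultimately show "ennreal (K * 2 powr (p * real_of_int i)) < g x" by (rule le_less_trans[rotated])
      qed
      also have "\<dots> = H i * indicator {0<..b i} t"
        using i True assms by (simp add: b_def field_simps)
      also have "\<dots> \<le> (\<integral>\<^sup>+ i. H i * indicator {0<..b i} t \<partial>count_space UNIV)"
        using nn_integral_ge_point[of i UNIV "\<lambda>i. H i * indicator {0<..b i} t"] by simp
      finally show ?thesis using True by simp
    qed simp
  qed
  also have "\<dots> = (\<integral>\<^sup>+ i. \<integral>\<^sup>+ t. H i * indicator {0<..b i} t \<partial>lborel \<partial>count_space UNIV)"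
    by (rule nn_integral_count_space_nn_integral) auto
  also have "\<dots> = (\<integral>\<^sup>+ i. ennreal (b i) * H i \<partial>count_space UNIV)"
    using assms by (intro nn_integral_cong) (simp add: nn_integral_cmult b_def mult.commute)
  finally show ?thesis by (simp only: b_def H_def)
qed

lemma dyadic_sum_le_choquet:
  fixes g :: "'a::metric_space \<Rightarrow> ennreal"
  assumes "p > 0"
  shows "(\<integral>\<^sup>+ j. ennreal ((1 - 2 powr - p) * 2 powr (p * real_of_int j)) * hausdorff_content \<delta> {x. g x > ennreal (2 powr (p * real_of_int j))} \<partial>count_space (UNIV :: int set))
    \<le> choquet_integral \<delta> UNIV g"
proof -
  define H where "H j = hausdorff_content \<delta> {x. g x > ennreal (2 powr (p * real_of_int j))}" for j :: int
  define J where "J j = {2 powr (p * (real_of_int j - 1)) <.. 2 powr (p * real_of_int j)}" for j :: int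
  have "(\<integral>\<^sup>+ j. ennreal ((1 - 2 powr - p) * 2 powr (p * real_of_int j)) * H j \<partial>count_space (UNIV :: int set))
    = (\<integral>\<^sup>+ j. \<integral>\<^sup>+ t. H j * indicator (J j) t \<partial>lborel \<partial>count_space (UNIV :: int set))"
  proof (intro nn_integral_cong)
    fix j :: int
    have "2 powr (p * real_of_int j) - 2 powr (p * (real_of_int j - 1)) = (1 - 2 powr - p) * 2 powr (p * real_of_int j)"
      by (simp add: algebra_simps flip: powr_add)
    moreover have "2 powr (p * (real_of_int j - 1)) \<le> 2 powr (p * real_of_int j)"
      using assms by (intro powr_mono) auto
    ultimately have "emeasure lborel (J j) = ennreal ((1 - 2 powr - p) * 2 powr (p * real_of_int j))"
      unfolding J_def by simp
    then show "ennreal ((1 - 2 powr - p) * 2 powr (p * real_of_int j)) * H j = (\<integral>\<^sup>+ t. H j * indicator (J j) t \<partial>lborel)"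
      by (subst nn_integral_cmult_indicator) (auto simp: J_def mult.commute)
  qed
  also have "\<dots> = (\<integral>\<^sup>+ t. \<integral>\<^sup>+ j. H j * indicator (J j) t \<partial>count_space (UNIV :: int set) \<partial>lborel)"
    by (rule nn_integral_count_space_nn_integral[symmetric]) (auto simp: J_def)
  also have "\<dots> \<le> choquet_integral \<delta> UNIV g"
    unfolding choquet_integral_def
  proof (intro nn_integral_mono)
    fix t :: real
    show "(\<integral>\<^sup>+ j. H j * indicator (J j) t \<partial>count_space (UNIV :: int set))
      \<le> hausdorff_content \<delta> {x \<in> UNIV. g x > ennreal t} * indicator {0<..} t"
    proof (cases "t > 0")
      case True
      obtain j0 :: int where j0: "2 powr (p * (real_of_int j0 - 1)) < t" "t \<le> 2 powr (p * real_of_int j0)"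
        using dyadic_index_ceiling[OF assms True] .
      have uniq: "j = j0" if "t \<in> J j" for j
      proof -
        have t: "2 powr (p * (real_of_int j - 1)) < t" "t \<le> 2 powr (p * real_of_int j)"
          using that by (auto simp: J_def)
        have "2 powr (p * (real_of_int j - 1)) < 2 powr (p * real_of_int j0)"
          "2 powr (p * (real_of_int j0 - 1)) < 2 powr (p * real_of_int j)"
          using t j0 by (auto intro: less_le_trans simp del: powr_less_cancel_iff)
        then have "real_of_int j - 1 < real_of_int j0" "real_of_int j0 - 1 < real_of_int j"
          using assms by auto
        then show ?thesis by linarith
      qed
      have J_iff: "t \<in> J j \<longleftrightarrow> j = j0" for j
        using uniq[of j] j0 by (auto simp: J_def)
      have "(\<integral>\<^sup>+ j. H j * indicator (J j) t \<partial>count_space (UNIV :: int set)) = (\<integral>\<^sup>+ j. H j * indicator {j0} j \<partial>count_space (UNIV :: int set))"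
        by (simp add: indicator_def J_iff)
      also have "\<dots> = H j0" by simp
      also have "\<dots> \<le> hausdorff_content \<delta> {x \<in> UNIV. g x > ennreal t}"
        unfolding H_def
      proof (rule content_mono, clarsimp)
        fix x assume "ennreal (2 powr (p * real_of_int j0)) < g x"
        moreover have "ennreal t \<le> ennreal (2 powr (p * real_of_int j0))"
          using j0 by (intro ennreal_leI) simp
        ultimately show "ennreal t < g x" by (rule le_less_trans[rotated])
      qed
      finally show ?thesis using True by simp
    next
      case False
      have "t \<notin> J j" for j
        using False powr_ge_zero[of 2 "p * (real_of_int j - 1)"]
        by (simp add: J_def del: powr_ge_zero)
      then show ?thesis by simp
    qed
  qed
  finally show ?thesis by (simp only: H_def)
qed

lemma ennreal_powr_le:
  assumes "X \<le> ennreal z" "0 \<le> z" "0 < q"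
  shows "ennreal_powr X q \<le> ennreal (z powr q)"
proof -
  from assms(1) obtain x where "X = ennreal x" "x \<ge> 0" by (cases X) (auto simp: top_unique)
  then show ?thesis using assms by (auto simp: ennreal_powr_def intro!: ennreal_leI powr_mono2)
qed

lemma ennreal_powr_gt_iff:
  assumes "0 \<le> a" "0 < p"
  shows "ennreal (a powr p) < ennreal_powr X p \<longleftrightarrow> ennreal a < X"
proof (cases X)
  case (real x)
  then show ?thesis
    using assms powr_mono2[of p x a] powr_less_mono2[of p a x]
    by (cases "a < x") (auto simp: ennreal_powr_def ennreal_less_iff not_less)
qed (simp add: ennreal_powr_def)

section \<open>Pointwise bound for the Riesz potential\<close>

text \<open>
  Splitting the space into the annuli \<open>2 powr (k - 1) \<le> norm (x - y) < 2 powr k\<close> and the dyadic layers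
  of the function uses only countable subadditivity of the content on level sets; the point \<open>x\<close>
  and the set where the function is infinite are negligible.
\<close>

lemma riesz_potential_le_dyadic_sum:
  fixes f :: "real ^ 'n \<Rightarrow> ereal"
  assumes D: "0 < D" and \<alpha>: "\<alpha> < D"
    and null: "hausdorff_content D {y. e2ennreal \<bar>f y\<bar> = top} = 0"
  shows "content_riesz_potential D \<alpha> f x \<le> ennreal (2 powr (1 + D - \<alpha>)) *
    (\<integral>\<^sup>+ k. ennreal (2 powr ((\<alpha> - D) * real_of_int k)) *
       layer_sum D (\<lambda>j. {y. e2ennreal \<bar>f y\<bar> > ennreal (2 powr real_of_int j)}) (ball x (2 powr real_of_int k)) \<partial>count_space (UNIV :: int set))"
proof -
  define \<phi> where "\<phi> y = e2ennreal \<bar>f y\<bar>" for y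
  define g where "g y = \<phi> y / ennreal (norm (x - y) powr (D - \<alpha>))" for y
  define E where "E k j = {y. \<phi> y > ennreal (2 powr real_of_int j)} \<inter> ball x (2 powr real_of_int k)" for k j :: int
  define m where "m k j = 2 powr (1 + D - \<alpha>) * (2 powr ((\<alpha> - D) * real_of_int k) * 2 powr real_of_int j)" for k j :: int
  have m: "m k j > 0" for k j by (simp add: m_def)
  have level: "{y. g y > ennreal t} \<subseteq> ({y. \<phi> y = top} \<union> {x}) \<union> (\<Union>z. if t < m (fst z) (snd z) then E (fst z) (snd z) else {})"
    if t: "t > 0" for t
  proof
    fix y assume "y \<in> {y. g y > ennreal t}"
    then have gy: "g y > ennreal t" by simp
    show "y \<in> ({y. \<phi> y = top} \<union> {x}) \<union> (\<Union>z. if t < m (fst z) (snd z) then E (fst z) (snd z) else {})"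
    proof (cases "\<phi> y = top \<or> y = x")
      case False
      then obtain u where u: "\<phi> y = ennreal u" "u \<ge> 0" by (cases "\<phi> y") auto
      from False have "x \<noteq> y" by blast
      then have n: "norm (x - y) > 0" by simp
      have gu: "g y = ennreal (u / norm (x - y) powr (D - \<alpha>))"
        unfolding g_def u(1) using u n by (intro divide_ennreal) auto
      have "u \<noteq> 0" using gy by (auto simp: gu)
      then have u0: "u > 0" using u by simp
      obtain j :: int where j: "2 powr (1 * (real_of_int j - 1)) < u" "u \<le> 2 powr (1 * real_of_int j)"
        by (rule dyadic_index_ceiling[OF zero_less_one u0])
      obtain k :: int where k: "2 powr (1 * real_of_int k) \<le> norm (x - y)" "norm (x - y) < 2 powr (1 * (real_of_int k + 1))"
        by (rule dyadic_index_floor[OF zero_less_one n])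
      have "u / norm (x - y) powr (D - \<alpha>) \<le> 2 powr real_of_int j / (2 powr real_of_int k) powr (D - \<alpha>)"
        using j k \<alpha> u0 by (intro frac_le powr_mono2) auto
      also have "\<dots> = m (k + 1) (j - 1)"
        unfolding m_def powr_add[symmetric] powr_powr powr_diff[symmetric] by (simp add: algebra_simps)
      finally have "ennreal (u / norm (x - y) powr (D - \<alpha>)) \<le> ennreal (m (k + 1) (j - 1))" by (rule ennreal_leI)
      with gy gu have "ennreal t < ennreal (m (k + 1) (j - 1))" by simp
      then have "t < m (k + 1) (j - 1)" using t by (simp add: ennreal_less_iff)
      moreover have "y \<in> E (k + 1) (j - 1)"
        using j k u by (auto simp: E_def dist_norm ennreal_less_iff)
      ultimately have "y \<in> (\<Union>z. if t < m (fst z) (snd z) then E (fst z) (snd z) else {})"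
        by (intro UN_I[of "(k + 1, j - 1)"]) auto
      then show ?thesis by blast
    qed auto
  qed
  have "content_riesz_potential D \<alpha> f x = (\<integral>\<^sup>+ t. hausdorff_content D {y. g y > ennreal t} * indicator {0<..} t \<partial>lborel)"
    by (simp add: content_riesz_potential_def choquet_integral_def g_def \<phi>_def)
  also have "\<dots> \<le> (\<integral>\<^sup>+ t. \<integral>\<^sup>+ z. hausdorff_content D (E (fst z) (snd z)) * indicator {0<..m (fst z) (snd z)} t \<partial>count_space UNIV \<partial>lborel)"
  proof (intro nn_integral_mono)
    fix t :: real
    show "hausdorff_content D {y. g y > ennreal t} * indicator {0<..} t
      \<le> (\<integral>\<^sup>+ z. hausdorff_content D (E (fst z) (snd z)) * indicator {0<..m (fst z) (snd z)} t \<partial>count_space UNIV)"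
    proof (cases "t > 0")
      case True
      have "hausdorff_content D ({y. \<phi> y = top} \<union> {x}) \<le> 0"
        using content_Un_le[of D "{y. \<phi> y = top}" "{x}"] null content_singleton[OF D, of x] by (simp add: \<phi>_def)
      then have 0: "hausdorff_content D ({y. \<phi> y = top} \<union> {x}) = 0" by simp
      have "hausdorff_content D {y. g y > ennreal t}
        \<le> hausdorff_content D ({y. \<phi> y = top} \<union> {x}) + hausdorff_content D (\<Union>z. if t < m (fst z) (snd z) then E (fst z) (snd z) else {})"
        using content_mono[OF level[OF True]] content_Un_le by (rule order_trans)
      also have "\<dots> = hausdorff_content D (\<Union>z. if t < m (fst z) (snd z) then E (fst z) (snd z) else {})"
        by (simp only: 0 add_0)
      also have "\<dots> \<le> (\<integral>\<^sup>+ z. hausdorff_content D (if t < m (fst z) (snd z) then E (fst z) (snd z) else {}) \<partial>count_space UNIV)"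
        by (rule content_countable_subadd)
      also have "\<dots> \<le> (\<integral>\<^sup>+ z. hausdorff_content D (E (fst z) (snd z)) * indicator {0<..m (fst z) (snd z)} t \<partial>count_space UNIV)"
        using True by (intro nn_integral_mono) (auto split: split_indicator)
      finally show ?thesis using True by simp
    qed simp
  qed
  also have "\<dots> = (\<integral>\<^sup>+ z. \<integral>\<^sup>+ t. hausdorff_content D (E (fst z) (snd z)) * indicator {0<..m (fst z) (snd z)} t \<partial>lborel \<partial>count_space UNIV)"
    by (rule nn_integral_count_space_nn_integral) auto
  also have "\<dots> = (\<integral>\<^sup>+ z. ennreal (m (fst z) (snd z)) * hausdorff_content D (E (fst z) (snd z)) \<partial>count_space UNIV)"
    using m by (intro nn_integral_cong) (simp add: nn_integral_cmult less_imp_le mult.commute)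
  also have "\<dots> = (\<integral>\<^sup>+ k. \<integral>\<^sup>+ j. ennreal (m k j) * hausdorff_content D (E k j) \<partial>count_space UNIV \<partial>count_space UNIV)"
    by (subst nn_integral_fst_count_space[symmetric]) simp
  also have "\<dots> = (\<integral>\<^sup>+ k. ennreal (2 powr (1 + D - \<alpha>)) * (ennreal (2 powr ((\<alpha> - D) * real_of_int k)) *
       (\<integral>\<^sup>+ j. ennreal (2 powr real_of_int j) * hausdorff_content D (E k j) \<partial>count_space UNIV)) \<partial>count_space UNIV)"
    by (intro nn_integral_cong) (simp add: m_def ennreal_mult nn_integral_cmult mult.assoc)
  also have "\<dots> = ennreal (2 powr (1 + D - \<alpha>)) * (\<integral>\<^sup>+ k. ennreal (2 powr ((\<alpha> - D) * real_of_int k)) *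
       (\<integral>\<^sup>+ j. ennreal (2 powr real_of_int j) * hausdorff_content D (E k j) \<partial>count_space UNIV) \<partial>count_space UNIV)"
    by (rule nn_integral_cmult) simp
  finally show ?thesis by (simp only: E_def \<phi>_def)
qed

section \<open>The Sobolev inequality\<close>

theorem theorem5p4:
  fixes \<delta> \<alpha> p :: real
  assumes "0 < \<delta>" "\<delta> \<le> real CARD('n::finite)"
    and "0 < \<alpha>" "\<alpha> < \<delta>"
    and "\<delta> / real CARD('n) < p" "p < \<delta> / \<alpha>"
  shows "\<exists>c::real. c > 0 \<and>
    (\<forall>f :: real ^ 'n \<Rightarrow> ereal.
      ennreal_powr
        (choquet_integral \<delta> UNIV
          (\<lambda>x. ennreal_powr (content_riesz_potential (real CARD('n)) \<alpha> f x)
                 (\<delta> * p / (\<delta> - p * \<alpha>))))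
        ((\<delta> - p * \<alpha>) / (\<delta> * p))
      \<le> ennreal c *
        ennreal_powr (choquet_integral \<delta> UNIV (\<lambda>x. ennreal_powr (e2ennreal \<bar>f x\<bar>) p)) (1 / p))"
proof -
  define D where "D = real CARD('n)"
  have \<delta>: "0 < \<delta>" "\<delta> \<le> D" and \<alpha>: "0 < \<alpha>" "\<alpha> < D" and pD: "\<delta> / D < p" "p < \<delta> / \<alpha>"
    using assms by (auto simp: D_def)
  have D: "D > 0" and p: "p > 0" using \<delta> pD by (auto intro: less_trans[of 0 "\<delta> / D"])
  have p\<alpha>: "p * \<alpha> < \<delta>" using pD \<alpha> by (simp add: field_simps)
  define q where "q = \<delta> * p / (\<delta> - p * \<alpha>)"
  have q: "q > 0" using \<delta> p p\<alpha> by (simp add: q_def)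
  have q_inv: "(\<delta> - p * \<alpha>) / (\<delta> * p) = 1 / q" by (simp add: q_def)
  have qp: "(1 - \<alpha> * p / \<delta>) * q = p" using \<delta> p\<alpha> by (simp add: q_def field_simps)
  then have q_sum: "\<alpha> / \<delta> * q + 1 = q / p" using p by (simp add: field_simps)
  obtain C1 where C1: "C1 > 0" and strong: "\<And>F :: int \<Rightarrow> (real ^ 'n) set.
    (\<integral>\<^sup>+ i. ennreal (2 powr (p * real_of_int i)) * hausdorff_content \<delta>
        {x. \<exists>r>0. layer_sum D F (ball x r)
              > ennreal (2 powr real_of_int i * r powr D)} \<partial>count_space UNIV)
    \<le> ennreal C1 * (\<integral>\<^sup>+ j. ennreal (2 powr (p * real_of_int j)) * hausdorff_content \<delta> (F j) \<partial>count_space UNIV)"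
    using layered_maximal_strong[OF \<delta> pD(1)] by blast
  obtain C2 where C2: "C2 > 0" and hedberg: "\<And>(F :: int \<Rightarrow> (real ^ 'n) set) x B T. B > 0 \<Longrightarrow> T > 0 \<Longrightarrow>
    (\<And>j. hausdorff_content \<delta> (F j) < ennreal (B * 2 powr (- p * real_of_int j))) \<Longrightarrow>
    (\<And>k. layer_sum D F (ball x (2 powr real_of_int k))
        \<le> ennreal (T * 2 powr (D * real_of_int k))) \<Longrightarrow>
    (\<integral>\<^sup>+ k. ennreal (2 powr ((\<alpha> - D) * real_of_int k)) *
       layer_sum D F (ball x (2 powr real_of_int k)) \<partial>count_space (UNIV :: int set))
    \<le> ennreal (C2 * B powr (\<alpha> / \<delta>) * T powr (1 - \<alpha> * p / \<delta>))"
    using hedberg_dyadic[OF \<delta> \<alpha>(1) pD] by blast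
  define \<gamma> where "\<gamma> = 1 - 2 powr - p"
  have \<gamma>: "\<gamma> > 0" using p by (simp add: \<gamma>_def powr_less_one)
  define A where "A = 2 powr (1 + D - \<alpha>)"
  have A: "A > 0" by (simp add: A_def)
  define C3 where "C3 = (A * C2) powr q * (2 / \<gamma>) powr (\<alpha> / \<delta> * q) * 2 powr p * C1 / \<gamma>"
  have C3: "C3 > 0" using A C1 C2 \<gamma> by (simp add: C3_def)
  \<comment> \<open>a positive upper bound \<open>M\<close> replaces the integral itself, since that may vanish\<close>
  have main: "ennreal_powr (choquet_integral \<delta> UNIV (\<lambda>x. ennreal_powr (content_riesz_potential D \<alpha> f x) q)) (1 / q)
      \<le> ennreal (C3 powr (1 / q) * M powr (1 / p))"
    if M: "M > 0" and N: "choquet_integral \<delta> UNIV (\<lambda>x. ennreal_powr (e2ennreal \<bar>f x\<bar>) p) \<le> ennreal M"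
    for f :: "real ^ 'n \<Rightarrow> ereal" and M
  proof -
    define F where "F j = {y. e2ennreal \<bar>f y\<bar> > ennreal (2 powr real_of_int j)}" for j :: int
    have F_eq: "F j = {y. ennreal_powr (e2ennreal \<bar>f y\<bar>) p > ennreal (2 powr (p * real_of_int j))}" for j
      using ennreal_powr_gt_iff[of "2 powr real_of_int j" p] p by (simp add: F_def powr_powr mult.commute)
    have "(\<integral>\<^sup>+ j. ennreal \<gamma> * (ennreal (2 powr (p * real_of_int j)) * hausdorff_content \<delta> (F j)) \<partial>count_space UNIV)
        = (\<integral>\<^sup>+ j. ennreal (\<gamma> * 2 powr (p * real_of_int j)) * hausdorff_content \<delta> (F j) \<partial>count_space UNIV)"
      using \<gamma> by (intro nn_integral_cong) (simp add: ennreal_mult mult.assoc)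
    also have "\<dots> \<le> choquet_integral \<delta> UNIV (\<lambda>x. ennreal_powr (e2ennreal \<bar>f x\<bar>) p)"
      unfolding F_eq \<gamma>_def by (rule dyadic_sum_le_choquet[OF p])
    finally have "ennreal \<gamma> * (\<integral>\<^sup>+ j. ennreal (2 powr (p * real_of_int j)) * hausdorff_content \<delta> (F j) \<partial>count_space UNIV) \<le> ennreal M"
      using N by (simp add: nn_integral_cmult)
    then have "ennreal (1 / \<gamma>) * (ennreal \<gamma> * (\<integral>\<^sup>+ j. ennreal (2 powr (p * real_of_int j)) * hausdorff_content \<delta> (F j) \<partial>count_space UNIV))
        \<le> ennreal (1 / \<gamma>) * ennreal M" by (rule mult_left_mono) simp
    moreover have "ennreal (1 / \<gamma>) * ennreal \<gamma> = 1" using \<gamma> by (simp flip: ennreal_mult)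
    ultimately have total: "(\<integral>\<^sup>+ j. ennreal (2 powr (p * real_of_int j)) * hausdorff_content \<delta> (F j) \<partial>count_space UNIV) \<le> ennreal (M / \<gamma>)"
      using \<gamma> M by (simp only: mult.assoc[symmetric] mult_1_left) (simp flip: ennreal_mult)
    define B where "B = 2 * M / \<gamma>"
    have B: "B > 0" using M \<gamma> by (simp add: B_def)
    have hF: "hausdorff_content \<delta> (F j) < ennreal (B * 2 powr (- p * real_of_int j))" for j
    proof -
      have "ennreal (2 powr (p * real_of_int j)) * hausdorff_content \<delta> (F j) \<le> ennreal (M / \<gamma>)"
        by (rule order_trans[OF _ total]) (rule nn_integral_ge_point, simp)
      then have "ennreal (2 powr (- p * real_of_int j)) * (ennreal (2 powr (p * real_of_int j)) * hausdorff_content \<delta> (F j))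
          \<le> ennreal (2 powr (- p * real_of_int j)) * ennreal (M / \<gamma>)" by (rule mult_left_mono) simp
      moreover have "ennreal (2 powr (- p * real_of_int j)) * ennreal (2 powr (p * real_of_int j)) = 1"
        by (simp flip: ennreal_mult powr_add)
      ultimately have "hausdorff_content \<delta> (F j) \<le> ennreal (2 powr (- p * real_of_int j)) * ennreal (M / \<gamma>)"
        by (simp only: mult.assoc[symmetric] mult_1_left)
      also have "\<dots> = ennreal (2 powr (- p * real_of_int j) * (M / \<gamma>))"
        using M \<gamma> by (simp flip: ennreal_mult)
      also have "\<dots> < ennreal (B * 2 powr (- p * real_of_int j))"
        using M \<gamma> by (intro ennreal_lessI) (auto simp: B_def field_simps)
      finally show ?thesis .
    qed
    \<comment> \<open>the set of infinite values lies in every \<open>F j\<close>, and the contents of these tend to 0\<close>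
    have null: "hausdorff_content D {y. e2ennreal \<bar>f y\<bar> = top} = 0"
    proof (rule antisym)
      show "hausdorff_content D {y. e2ennreal \<bar>f y\<bar> = top} \<le> 0"
      proof (rule ennreal_le_epsilon)
        fix e :: real assume e: "0 < e"
        define b where "b = e powr (\<delta> / D)"
        have b: "b > 0" using e by (simp add: b_def)
        obtain j :: int where "B / b \<le> 2 powr (p * real_of_int j)"
          using dyadic_index_ceiling[OF p, of "B / b"] B b by auto
        then have jb: "B * 2 powr (- p * real_of_int j) \<le> b"
          using b by (simp add: powr_minus field_simps)
        have "hausdorff_content \<delta> {y. e2ennreal \<bar>f y\<bar> = top} \<le> hausdorff_content \<delta> (F j)"
          by (rule content_mono) (auto simp: F_def)
        also have "\<dots> < ennreal (B * 2 powr (- p * real_of_int j))" by (rule hF)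
        also have "\<dots> \<le> ennreal b" using jb by (rule ennreal_leI)
        finally have "hausdorff_content D {y. e2ennreal \<bar>f y\<bar> = top} \<le> ennreal (b powr (D / \<delta>))"
          using b \<delta> by (intro content_higher_exponent_le) auto
        also have "b powr (D / \<delta>) = e" using e \<delta> D by (simp add: b_def powr_powr)
        finally show "hausdorff_content D {y. e2ennreal \<bar>f y\<bar> = top} \<le> 0 + ennreal e" by simp
      qed
    qed simp
    define U where "U i = {x. \<exists>r>0. layer_sum D F (ball x r)
              > ennreal (2 powr real_of_int i * r powr D)}" for i :: int
    \<comment> \<open>\<open>K\<close> is chosen so that Hedberg's inequality bounds the \<open>q\<close>-th power of the potential by
      \<open>K * 2 powr (p * i)\<close> wherever the maximal function is at most \<open>2 powr i\<close>\<close>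
    define K where "K = (A * C2 * B powr (\<alpha> / \<delta>)) powr q"
    have K: "K > 0" using A C2 B by (simp add: K_def)
    have level: "{x. ennreal_powr (content_riesz_potential D \<alpha> f x) q > ennreal (K * 2 powr (p * real_of_int i))} \<subseteq> U i" for i
    proof (rule subsetI, rule ccontr)
      fix x assume x: "x \<in> {x. ennreal_powr (content_riesz_potential D \<alpha> f x) q > ennreal (K * 2 powr (p * real_of_int i))}"
        and nU: "x \<notin> U i"
      define T where "T = 2 powr real_of_int i"
      have T: "T > 0" by (simp add: T_def)
      have "layer_sum D F (ball x (2 powr real_of_int k))
          \<le> ennreal (T * 2 powr (D * real_of_int k))" for k :: int
      proof -
        have "\<not> layer_sum D F (ball x r)
          > ennreal (T * r powr D)" if "r > 0" for r
          using nU that unfolding U_def T_def by blast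
        from this[of "2 powr real_of_int k"] show ?thesis
          by (simp add: powr_powr mult.commute[of _ D] not_less)
      qed
      note hb = hedberg[OF B T hF this]
      have "content_riesz_potential D \<alpha> f x \<le> ennreal A * ennreal (C2 * B powr (\<alpha> / \<delta>) * T powr (1 - \<alpha> * p / \<delta>))"
        unfolding A_def
        by (rule order_trans[OF riesz_potential_le_dyadic_sum[OF D \<alpha>(2) null] mult_left_mono[OF hb[unfolded F_def]]]) simp
      also have "\<dots> = ennreal (A * C2 * B powr (\<alpha> / \<delta>) * T powr (1 - \<alpha> * p / \<delta>))"
        using A C2 by (simp add: mult.assoc flip: ennreal_mult)
      finally have "ennreal_powr (content_riesz_potential D \<alpha> f x) q
          \<le> ennreal ((A * C2 * B powr (\<alpha> / \<delta>) * T powr (1 - \<alpha> * p / \<delta>)) powr q)"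
        using A C2 q by (intro ennreal_powr_le) auto
      also have "(A * C2 * B powr (\<alpha> / \<delta>) * T powr (1 - \<alpha> * p / \<delta>)) powr q = K * T powr ((1 - \<alpha> * p / \<delta>) * q)"
        using A C2 by (simp add: K_def powr_mult powr_powr)
      also have "T powr ((1 - \<alpha> * p / \<delta>) * q) = 2 powr (p * real_of_int i)"
        unfolding qp by (simp add: T_def powr_powr mult.commute)
      finally show False using x by simp
    qed
    have "choquet_integral \<delta> UNIV (\<lambda>x. ennreal_powr (content_riesz_potential D \<alpha> f x) q)
      \<le> (\<integral>\<^sup>+ i. ennreal (K * 2 powr (p * (real_of_int i + 1))) *
           hausdorff_content \<delta> {x. ennreal_powr (content_riesz_potential D \<alpha> f x) q > ennreal (K * 2 powr (p * real_of_int i))} \<partial>count_space (UNIV :: int set))"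
      by (rule choquet_le_dyadic_sum[OF K p])
    also have "\<dots> \<le> (\<integral>\<^sup>+ i. ennreal (K * 2 powr (p * (real_of_int i + 1))) * hausdorff_content \<delta> (U i) \<partial>count_space (UNIV :: int set))"
      by (intro nn_integral_mono mult_left_mono content_mono level) simp
    also have "\<dots> = (\<integral>\<^sup>+ i. ennreal (K * 2 powr p) * (ennreal (2 powr (p * real_of_int i)) * hausdorff_content \<delta> (U i)) \<partial>count_space (UNIV :: int set))"
    proof (intro nn_integral_cong)
      fix i :: int
      have "K * 2 powr (p * (real_of_int i + 1)) = K * 2 powr p * 2 powr (p * real_of_int i)"
        by (simp add: distrib_left powr_add)
      then show "ennreal (K * 2 powr (p * (real_of_int i + 1))) * hausdorff_content \<delta> (U i)
        = ennreal (K * 2 powr p) * (ennreal (2 powr (p * real_of_int i)) * hausdorff_content \<delta> (U i))"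
        using K by (simp add: ennreal_mult mult.assoc)
    qed
    also have "\<dots> = ennreal (K * 2 powr p) * (\<integral>\<^sup>+ i. ennreal (2 powr (p * real_of_int i)) * hausdorff_content \<delta> (U i) \<partial>count_space (UNIV :: int set))"
      by (rule nn_integral_cmult) simp
    also have "\<dots> \<le> ennreal (K * 2 powr p) * (ennreal C1 * ennreal (M / \<gamma>))"
      unfolding U_def by (intro mult_left_mono order_trans[OF strong mult_left_mono] total) auto
    also have "\<dots> = ennreal (K * 2 powr p * C1 * (M / \<gamma>))"
      using K C1 M \<gamma> by (simp add: mult.assoc flip: ennreal_mult)
    also have "K * 2 powr p * C1 * (M / \<gamma>) = C3 * M powr (q / p)"
    proof -
      have "B powr (\<alpha> / \<delta> * q) = (2 / \<gamma>) powr (\<alpha> / \<delta> * q) * M powr (\<alpha> / \<delta> * q)"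
        using M \<gamma> by (simp add: B_def flip: powr_mult)
      moreover have "K = (A * C2) powr q * B powr (\<alpha> / \<delta> * q)"
        using A C2 B by (simp add: K_def powr_mult powr_powr)
      moreover have "M powr (q / p) = M powr (\<alpha> / \<delta> * q) * M"
        using M by (simp only: q_sum[symmetric] powr_add powr_one)
      ultimately show ?thesis by (simp add: C3_def)
    qed
    finally have "ennreal_powr (choquet_integral \<delta> UNIV (\<lambda>x. ennreal_powr (content_riesz_potential D \<alpha> f x) q)) (1 / q)
        \<le> ennreal ((C3 * M powr (q / p)) powr (1 / q))"
      using C3 q by (intro ennreal_powr_le) auto
    also have "(C3 * M powr (q / p)) powr (1 / q) = C3 powr (1 / q) * M powr (1 / p)"
      using C3 M q by (simp add: powr_mult powr_powr)
    finally show ?thesis .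
  qed
  define c where "c = C3 powr (1 / q)"
  have c: "c > 0" using C3 by (simp add: c_def)
  show ?thesis
    unfolding q_inv q_def[symmetric] D_def[symmetric]
  proof (intro exI[of _ c] conjI allI c)
    fix f :: "real ^ 'n \<Rightarrow> ereal"
    define N where "N = choquet_integral \<delta> UNIV (\<lambda>x. ennreal_powr (e2ennreal \<bar>f x\<bar>) p)"
    define L where "L = ennreal_powr (choquet_integral \<delta> UNIV (\<lambda>x. ennreal_powr (content_riesz_potential D \<alpha> f x) q)) (1 / q)"
    have L: "L \<le> ennreal (c * M powr (1 / p))" if "M > 0" "N \<le> ennreal M" for M
      using main[of M f] that by (simp add: L_def N_def c_def)
    have "L \<le> ennreal c * ennreal_powr N (1 / p)"
    proof (cases N)
      case (real n)
      show ?thesis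
      proof (cases "n = 0")
        case False
        then have "L \<le> ennreal (c * n powr (1 / p))" using real by (intro L) auto
        then show ?thesis using real c by (simp add: ennreal_powr_def ennreal_mult)
      next
        case True
        have "L \<le> 0"
        proof (rule ennreal_le_epsilon)
          fix e :: real assume e: "0 < e"
          have "L \<le> ennreal (c * ((e / c) powr p) powr (1 / p))"
            using e c real True by (intro L) auto
          also have "c * ((e / c) powr p) powr (1 / p) = e"
            using e c p by (simp add: powr_powr)
          finally show "L \<le> 0 + ennreal e" by simp
        qed
        then show ?thesis by simp
      qed
    next
      case top
      have "ennreal c \<noteq> 0" using c by simp
      then show ?thesis by (simp add: top ennreal_powr_def ennreal_mult_top)
    qed
    then show "ennreal_powr (choquet_integral \<delta> UNIV (\<lambda>x. ennreal_powr (content_riesz_potential D \<alpha> f x) q)) (1 / q)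
      \<le> ennreal c * ennreal_powr (choquet_integral \<delta> UNIV (\<lambda>x. ennreal_powr (e2ennreal \<bar>f x\<bar>) p)) (1 / p)"
      by (simp only: L_def N_def)
  qed
qed

end
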